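(* Let $h:\mathbb{R}^d\times\Lambda\to\mathbb{R}$, the distribution $\mathbb{P}_\lambda$ on $\Lambda$, and the basis $\Phi(\lambda)=[\Phi_1(\lambda)\ \cdots\ \Phi_p(\lambda)]\in\mathbb{R}^{d\times p}$ be as in the context. Assume: (1) there are constants $0<\mu\le L$ such that for all $\lambda\in\Lambda$ the function $h(\cdot,\lambda)$ is $\mu$-strongly convex and $L$-smooth; (2) there is no $\beta\in\mathbb{R}^p$, $\beta\neq 0$, with $\Phi(\tilde\lambda)\beta=0$ for $\mathbb{P}_\lambda$-almost every $\tilde\lambda$. Let $\bar\eta\in(0,1]$, let $\beta_0\in\mathbb{R}^p$, and consider the stochastic gradient descent iteration with constant step-size $\eta=\frac{\bar\eta}{CL}$, $$\beta_{t+1}=\beta_t-\eta\,\Phi(\tilde\lambda_t)^\top\nabla_\theta h(\Phi(\tilde\lambda_t)\beta_t,\tilde\lambda_t),\qquad t=0,1,2,\dots,$$ where $\tilde\lambda_0,\tilde\lambda_1,\dots$ are i.i.d. samples from $\mathbb{P}_\lambda$. Then, for every $T\ge 0$, $$\mathbb{E}[\epsilon_{\rm sp}(\beta_T)]\ \le\ 2CL\|\beta_0-\beta^*_{\rm avg}\|^2\left(1-\frac{\bar\eta c\mu}{CL}\right)^T+\left(\frac{4CL(\bar\eta+2)}{c\mu}\right)\epsilon_{\rm sp}^*.$$ In particular, if $\epsilon_{\rm sp}^*>0$, then for every $T\ge\left\lceil\frac{CL}{\bar\eta c\mu}\log\left(\frac{c\mu\|\beta_0-\beta^*_{\rm avg}\|^2}{2\bar\eta\,\epsilon_{\rm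 sp}^*}\right)\right\rceil$, $$\mathbb{E}[\epsilon_{\rm sp}(\beta_T)]\ \le\ \left(\frac{8CL(\bar\eta+1)}{c\mu}\right)\epsilon_{\rm sp}^*;$$ and if $\epsilon_{\rm sp}^*=0$, then for every $\epsilon>0$ and every $T\ge\left\lceil\frac{CL}{\bar\eta c\mu}\log\left(\frac{2CL\|\beta_0-\beta^*_{\rm avg}\|^2}{\epsilon}\right)\right\rceil$, $$\mathbb{E}[\epsilon_{\rm sp}(\beta_T)]\ \le\ \epsilon.$$
   Context: $\|\cdot\|$ is the Euclidean norm. $\Lambda$ is an arbitrary set of parameters carrying a probability distribution $\mathbb{P}_\lambda$. $h:\mathbb{R}^d\times\Lambda\to\mathbb{R}$ is such that for each $\lambda\in\Lambda$ the problem $\min_{\theta\in\mathbb{R}^d}h(\theta,\lambda)$ admits an optimal solution, denoted $\theta^*(\lambda)$. "$h(\cdot,\lambda)$ is $\mu$-strongly convex and $L$-smooth" means: for all $\theta,\bar\theta\in\mathbb{R}^d$, $\frac{\mu}{2}\|\theta-\bar\theta\|^2\le h(\theta,\lambda)-h(\bar\theta,\lambda)-\nabla_\theta h(\bar\theta,\lambda)^\top(\theta-\bar\theta)\le\frac{L}{2}\|\theta-\bar\theta\|^2$. Basis functions: $\Phi_j:\Lambda\to\mathbb{R}^d$, $j=1,\dots,p$, and $\Phi(\lambda)\in\mathbb{R}^{d\times p}$ is the matrix with columns $\Phi_j(\lambda)$. All functions are measurable in $\lambda$ as needed and all expectations over $\tilde\lambda\sim\mathbb{P}_\lambda$ are well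 defined and finite. Solution path error of $\beta\in\mathbb{R}^p$: $\epsilon_{\rm sp}(\beta):=\sup_{\lambda\in\Lambda}\{h(\Phi(\lambda)\beta,\lambda)-h(\theta^*(\lambda),\lambda)\}$. Minimal solution path error of the basis: $\epsilon_{\rm sp}^*:=\inf_{\beta\in\mathbb{R}^p}\epsilon_{\rm sp}(\beta)$. Constants (finite): $C:=\sup_{\lambda\in\Lambda}\sigma_{\max}(\Phi(\lambda)^\top\Phi(\lambda))$ (largest eigenvalue) and $c:=\sigma_{\min}(\mathbb{E}_{\tilde\lambda\sim\mathbb{P}_\lambda}[\Phi(\tilde\lambda)^\top\Phi(\tilde\lambda)])$ (smallest eigenvalue). $\beta^*_{\rm avg}\in\arg\min_{\beta\in\mathbb{R}^p}\mathbb{E}_{\tilde\lambda\sim\mathbb{P}_\lambda}[h(\Phi(\tilde\lambda)\beta,\tilde\lambda)]$. The outer expectation $\mathbb{E}[\epsilon_{\rm sp}(\beta_T)]$ is over the samples $\tilde\lambda_0,\dots,\tilde\lambda_{T-1}$. Convention: $\log 0=-\infty$. *)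

theory Defs
  imports "HOL-Probability.Probability"
begin

definition strongly_convex_smooth ::
    "real \<Rightarrow> real \<Rightarrow> ('a::real_inner \<Rightarrow> real) \<Rightarrow> ('a \<Rightarrow> 'a) \<Rightarrow> bool" where
  "strongly_convex_smooth \<mu> L f f' \<longleftrightarrow>
     (\<forall>\<theta> \<theta>'. \<mu> / 2 * (norm (\<theta> - \<theta>'))\<^sup>2 \<le> f \<theta> - f \<theta>' - f' \<theta>' \<bullet> (\<theta> - \<theta>') \<and>
             f \<theta> - f \<theta>' - f' \<theta>' \<bullet> (\<theta> - \<theta>') \<le> L / 2 * (norm (\<theta> - \<theta>'))\<^sup>2)"

definition eigenvalues :: "real ^ 'n ^ 'n \<Rightarrow> real set" where
  "eigenvalues A = {k. \<exists>v. v \<noteq> 0 \<and> A *v v = k *\<^sub>R v}"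

text \<open>Only applied to symmetric matrices, whose set of (real) eigenvalues is finite and
  nonempty, so that \<^term>\<open>Max\<close> and \<^term>\<open>Min\<close> are meaningful.\<close>

definition sigma_max :: "real ^ 'n ^ 'n \<Rightarrow> real" where
  "sigma_max A = Max (eigenvalues A)"

definition sigma_min :: "real ^ 'n ^ 'n \<Rightarrow> real" where
  "sigma_min A = Min (eigenvalues A)"

text \<open>The basis is given by the matrix \<open>\<Phi> \<lambda>\<close> with \<open>CARD('d)\<close> rows and \<open>CARD('p)\<close> columns;
  the \<open>j\<close>-th basis function is \<open>\<lambda>l. column j (\<Phi> l)\<close>. The supremum below may be infinite,
  hence the extended real values.\<close>

definition sp_error ::
    "'l set \<Rightarrow> (real ^ 'd \<Rightarrow> 'l \<Rightarrow> real) \<Rightarrow> ('l \<Rightarrow> real ^ 'd) \<Rightarrow> ('l \<Rightarrow> real ^ 'p ^ 'd)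
      \<Rightarrow> real ^ 'p \<Rightarrow> ereal" where
  "sp_error \<Lambda> h \<theta>opt \<Phi> \<beta> = (SUP l\<in>\<Lambda>. ereal (h (\<Phi> l *v \<beta>) l - h (\<theta>opt l) l))"

definition min_sp_error ::
    "'l set \<Rightarrow> (real ^ 'd \<Rightarrow> 'l \<Rightarrow> real) \<Rightarrow> ('l \<Rightarrow> real ^ 'd) \<Rightarrow> ('l \<Rightarrow> real ^ 'p ^ 'd) \<Rightarrow> ereal" where
  "min_sp_error \<Lambda> h \<theta>opt \<Phi> = (INF \<beta>. sp_error \<Lambda> h \<theta>opt \<Phi> \<beta>)"

primrec sgd ::
    "real \<Rightarrow> ('l \<Rightarrow> real ^ 'p ^ 'd) \<Rightarrow> (real ^ 'd \<Rightarrow> 'l \<Rightarrow> real ^ 'd) \<Rightarrow> real ^ 'p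
      \<Rightarrow> (nat \<Rightarrow> 'l) \<Rightarrow> nat \<Rightarrow> real ^ 'p" where
  "sgd \<eta> \<Phi> gradh \<beta>0 s 0 = \<beta>0"
| "sgd \<eta> \<Phi> gradh \<beta>0 s (Suc t) =
     (let \<beta> = sgd \<eta> \<Phi> gradh \<beta>0 s t
      in \<beta> - \<eta> *\<^sub>R (transpose (\<Phi> (s t)) *v gradh (\<Phi> (s t) *v \<beta>) (s t)))"

text \<open>Expectation of a nonnegative extended real random variable, possibly infinite
  (\<^term>\<open>e2ennreal\<close> would truncate negative values to 0).\<close>

definition ereal_expectation :: "'w measure \<Rightarrow> ('w \<Rightarrow> ereal) \<Rightarrow> ereal" where
  "ereal_expectation P X = enn2ereal (\<integral>\<^sup>+ \<omega>. e2ennreal (X \<omega>) \<partial>P)"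

text \<open>Logarithm with the convention \<open>log 0 = -\<infinity>\<close> (the library has \<open>ln 0 = 0\<close> on the reals),
  and the ceiling that leaves \<open>\<plusminus>\<infinity>\<close> unchanged.\<close>

definition ereal_ln :: "ereal \<Rightarrow> ereal" where
  "ereal_ln x = (if x \<le> 0 then -\<infinity> else if x = \<infinity> then \<infinity> else ereal (ln (real_of_ereal x)))"

definition ereal_ceiling :: "ereal \<Rightarrow> ereal" where
  "ereal_ceiling x = (if \<bar>x\<bar> = \<infinity> then x else ereal (of_int \<lceil>real_of_ereal x\<rceil>))"

end

theory Submission
  imports Defs
begin

text \<open>Smoothness and strong convexity bound every path error \<open>h (\<Phi> l *v \<beta>) l - h (\<theta>opt l) l\<close> from
  both sides by the squared distance from \<open>\<Phi> l *v \<beta>\<close> to \<open>\<theta>opt l\<close>. A reference point whose path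
  error is at most \<open>e\<close> is therefore within \<open>O(e)\<close> (in square) of \<open>\<beta>avg\<close>, and the path error of any
  \<open>\<beta>\<close> is at most \<open>2 C L \<parallel>\<beta> - \<beta>avg\<parallel>\<^sup>2 + O(e)\<close>. One step of stochastic gradient descent contracts
  \<open>E \<parallel>\<beta> - \<beta>avg\<parallel>\<^sup>2\<close> by the factor \<open>1 - \<eta> c \<mu>\<close> up to a noise term which is also \<open>O(e)\<close>: the squared
  stochastic gradient is at most \<open>2 C L\<close> times the current path error, and for \<open>\<eta> C L \<le> 1\<close> the
  part of it exceeding the error of the reference point is absorbed by the first-order
  decrease. The theorem follows on letting \<open>e\<close> tend to the minimal solution path error.\<close>

section \<open>Extreme eigenvalues of symmetric matrices\<close>

text \<open>The default rule turns \<open>transpose A *v x\<close> into \<open>x v* A\<close>;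
  without it, products keep the form in which \<open>sgd\<close> is written.\<close>

declare transpose_matrix_vector [simp del]

lemma inner_matrix_transpose:
  fixes A :: "real ^ 'n ^ 'm"
  shows "x \<bullet> (A *v y) = (transpose A *v x) \<bullet> y"
  by (metis dot_lmul_matrix transpose_matrix_vector)

text \<open>Eigenvectors for distinct eigenvalues are orthogonal, so picking one per eigenvalue
  gives an independent set. Finiteness makes \<open>Max\<close> and \<open>Min\<close> of the
  eigenvalues meaningful.\<close>

lemma finite_eigenvalues_symmetric:
  fixes A :: "real ^ 'n ^ 'n"
  assumes sym: "transpose A = A"
  shows "finite (eigenvalues A)"
proof -
  define e where "e k = (SOME v. v \<noteq> 0 \<and> A *v v = k *\<^sub>R v)" for k
  have e: "e k \<noteq> 0 \<and> A *v e k = k *\<^sub>R e k" if "k \<in> eigenvalues A" for k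
    using that unfolding eigenvalues_def e_def mem_Collect_eq by (rule someI_ex)
  have orth: "e j \<bullet> e k = 0" if "j \<in> eigenvalues A" "k \<in> eigenvalues A" "j \<noteq> k" for j k
  proof -
    have "e j \<bullet> (A *v e k) = (A *v e j) \<bullet> e k"
      using inner_matrix_transpose[of "e j" A "e k"] sym by simp
    then have "k * (e j \<bullet> e k) = j * (e j \<bullet> e k)"
      using e that by simp
    with that show ?thesis by simp
  qed
  have inj: "inj_on e (eigenvalues A)"
  proof (rule inj_onI)
    fix j k assume "j \<in> eigenvalues A" "k \<in> eigenvalues A" "e j = e k"
    then show "j = k" using orth[of j k] e[of k] by auto
  qed
  have "pairwise orthogonal (e ` eigenvalues A)"
    unfolding pairwise_def orthogonal_def using orth by auto
  moreover have "0 \<notin> e ` eigenvalues A"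
    using e by force
  ultimately have "independent (e ` eigenvalues A)"
    by (rule pairwise_orthogonal_independent)
  then have "finite (e ` eigenvalues A)"
    by (rule independent_imp_finite)
  then show ?thesis
    using inj by (rule finite_imageD)
qed

text \<open>A maximiser of the Rayleigh quotient is an isotropic vector of the positive semidefinite
  form \<open>k I - A\<close>, hence lies in its kernel.\<close>

lemma symmetric_max_eigenvalue:
  fixes A :: "real ^ 'n ^ 'n"
  assumes sym: "transpose A = A"
  obtains k where "k \<in> eigenvalues A" "\<And>v. v \<bullet> (A *v v) \<le> k * (norm v)\<^sup>2"
proof -
  have "continuous_on (sphere 0 1) (\<lambda>v. v \<bullet> (A *v v))"
    by (intro continuous_intros matrix_vector_mult_linear_continuous_on)
  then obtain u :: "real ^ 'n" where u: "norm u = 1"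
    and max: "\<And>v. norm v = 1 \<Longrightarrow> v \<bullet> (A *v v) \<le> u \<bullet> (A *v u)"
    using continuous_attains_sup[of "sphere (0 :: real ^ 'n) 1" "\<lambda>v. v \<bullet> (A *v v)"]
    by (auto simp: sphere_eq_empty)
  define k where "k = u \<bullet> (A *v u)"
  have le: "v \<bullet> (A *v v) \<le> k * (norm v)\<^sup>2" for v
  proof (cases "v = 0")
    case False
    have "(v /\<^sub>R norm v) \<bullet> (A *v (v /\<^sub>R norm v)) \<le> k"
      unfolding k_def using False by (intro max) simp
    then have "(v \<bullet> (A *v v)) / (norm v)\<^sup>2 \<le> k"
      by (simp add: matrix_vector_mult_scaleR power2_eq_square field_simps)
    with False show ?thesis by (simp add: field_simps)
  qed simp
  define w where "w = k *\<^sub>R u - A *v u"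
  have uw: "u \<bullet> (A *v w) = (A *v u) \<bullet> w"
    using inner_matrix_transpose[of u A w] sym by simp
  define q where "q = k * (norm w)\<^sup>2 - w \<bullet> (A *v w)"
  \<comment> \<open>This is the form \<open>k * (norm v)\<^sup>2 - v \<bullet> (A *v v)\<close>,
    nonnegative by \<open>le\<close>, expanded at \<open>v = u - t *\<^sub>R w\<close>. The constant
    term vanishes by the choice of \<open>k\<close>; the linear one is as stated because
    \<open>w\<close> is k I - A applied to \<open>u\<close>.\<close>
  have quad: "0 \<le> - 2 * t * (norm w)\<^sup>2 + t\<^sup>2 * q" for t :: real
  proof -
    have "A *v (u - t *\<^sub>R w) = A *v u - t *\<^sub>R (A *v w)"
      by (simp add: matrix_vector_mult_diff_distrib matrix_vector_mult_scaleR)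
    then have "(u - t *\<^sub>R w) \<bullet> (A *v (u - t *\<^sub>R w))
        = k - t * (w \<bullet> (A *v u)) - t * (u \<bullet> (A *v w)) + t\<^sup>2 * (w \<bullet> (A *v w))"
      by (simp add: k_def inner_diff_left inner_diff_right power2_eq_square algebra_simps)
    also have "\<dots> = k - 2 * t * ((A *v u) \<bullet> w) + t\<^sup>2 * (w \<bullet> (A *v w))"
      by (simp add: uw inner_commute[of w "A *v u"])
    finally have "(u - t *\<^sub>R w) \<bullet> (A *v (u - t *\<^sub>R w))
        = k - 2 * t * ((A *v u) \<bullet> w) + t\<^sup>2 * (w \<bullet> (A *v w))" .
    moreover have "(norm (u - t *\<^sub>R w))\<^sup>2 = 1 - 2 * t * (u \<bullet> w) + t\<^sup>2 * (norm w)\<^sup>2"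
      using u unfolding power2_norm_eq_inner norm_eq_1
      by (simp add: inner_diff_left inner_diff_right inner_commute[of w u]
          power2_eq_square algebra_simps)
    moreover note le[of "u - t *\<^sub>R w"]
    ultimately have "k - 2 * t * ((A *v u) \<bullet> w) + t\<^sup>2 * (w \<bullet> (A *v w))
        \<le> k * (1 - 2 * t * (u \<bullet> w) + t\<^sup>2 * (norm w)\<^sup>2)"
      by simp
    moreover have "k * (u \<bullet> w) - (A *v u) \<bullet> w = (norm w)\<^sup>2"
      unfolding power2_norm_eq_inner by (subst (3) w_def) (simp add: inner_diff_left)
    then have "2 * t * (k * (u \<bullet> w) - (A *v u) \<bullet> w) = 2 * t * (norm w)\<^sup>2"
      by simp
    ultimately show ?thesis
      unfolding q_def by (simp add: algebra_simps)
  qed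
  have "w = 0"
  proof (rule ccontr)
    assume "w \<noteq> 0"
    then have n: "(norm w)\<^sup>2 > 0" by simp
    \<comment> \<open>With this \<open>t\<close>, the product \<open>t * q\<close> is at most
      \<open>(norm w)\<^sup>2\<close>, whereas \<open>quad\<close> demands at least twice that. The
      added 1 covers \<open>q = 0\<close>.\<close>
    define t where "t = (norm w)\<^sup>2 / (\<bar>q\<bar> + 1)"
    have t: "0 < t"
      using n by (simp add: t_def)
    have "t * q \<le> t * (\<bar>q\<bar> + 1)"
      using t by (intro mult_left_mono) auto
    also have "\<dots> = (norm w)\<^sup>2"
      by (simp add: t_def)
    finally have tq: "t * q \<le> (norm w)\<^sup>2" .
    have "0 \<le> t * (- 2 * (norm w)\<^sup>2 + t * q)"
      using quad[of t] by (simp add: power2_eq_square algebra_simps)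
    with t have "2 * (norm w)\<^sup>2 \<le> t * q"
      by (simp add: zero_le_mult_iff)
    with tq n show False by simp
  qed
  then have "A *v u = k *\<^sub>R u" unfolding w_def by simp
  moreover have "u \<noteq> 0" using u by auto
  ultimately have "k \<in> eigenvalues A"
    unfolding eigenvalues_def by blast
  with le that show thesis by blast
qed

lemma quadratic_form_le_sigma_max:
  fixes A :: "real ^ 'n ^ 'n"
  assumes sym: "transpose A = A"
  shows "v \<bullet> (A *v v) \<le> sigma_max A * (norm v)\<^sup>2"
proof -
  obtain k where k: "k \<in> eigenvalues A" "\<And>v. v \<bullet> (A *v v) \<le> k * (norm v)\<^sup>2"
    using symmetric_max_eigenvalue[OF sym] by blast
  have "k \<le> sigma_max A"
    unfolding sigma_max_def using finite_eigenvalues_symmetric[OF sym] k(1) by simp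
  then have "k * (norm v)\<^sup>2 \<le> sigma_max A * (norm v)\<^sup>2"
    by (intro mult_right_mono) auto
  with k(2) show ?thesis by (rule order_trans)
qed

lemma uminus_matrix_vector_mult: "(- A) *v v = - (A *v (v :: real ^ 'n))" for A :: "real ^ 'n ^ 'm"
  by (simp add: vec_eq_iff matrix_vector_mult_def sum_negf)

text \<open>Both claims come from the maximal eigenvalue \<open>k\<close> of \<open>- A\<close>: its
  negative is an eigenvalue of \<open>A\<close> below the whole Rayleigh quotient, and
  \<open>Min\<close> lies below it in turn.\<close>

lemma sigma_min_symmetric:
  fixes A :: "real ^ 'n ^ 'n"
  assumes sym: "transpose A = A"
  shows sigma_min_in_eigenvalues: "sigma_min A \<in> eigenvalues A"
    and sigma_min_le_quadratic_form: "sigma_min A * (norm v)\<^sup>2 \<le> v \<bullet> (A *v v)"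
proof -
  have "transpose (- A) = - A"
    using sym by (simp add: vec_eq_iff transpose_def)
  then obtain k where k: "k \<in> eigenvalues (- A)" "\<And>v. v \<bullet> ((- A) *v v) \<le> k * (norm v)\<^sup>2"
    using symmetric_max_eigenvalue by blast
  then obtain u where "u \<noteq> 0" "- (A *v u) = k *\<^sub>R u"
    unfolding eigenvalues_def uminus_matrix_vector_mult by blast
  then have u: "u \<noteq> 0" "A *v u = (- k) *\<^sub>R u"
    by (simp, metis minus_minus scaleR_minus_left)
  then have mem: "- k \<in> eigenvalues A"
    unfolding eigenvalues_def by blast
  note fin = finite_eigenvalues_symmetric[OF sym]
  show "sigma_min A \<in> eigenvalues A"
    unfolding sigma_min_def using fin mem by (intro Min_in) auto
  have "sigma_min A * (norm v)\<^sup>2 \<le> - k * (norm v)\<^sup>2"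
    unfolding sigma_min_def using fin mem by (intro mult_right_mono Min_le) auto
  also have "\<dots> \<le> v \<bullet> (A *v v)"
    using k(2)[of v] by (simp add: uminus_matrix_vector_mult)
  finally show "sigma_min A * (norm v)\<^sup>2 \<le> v \<bullet> (A *v v)" .
qed

section \<open>Gram matrices and operator bounds\<close>

lemma inner_gram:
  fixes A :: "real ^ 'n ^ 'm"
  shows "v \<bullet> ((transpose A ** A) *v w) = (A *v v) \<bullet> (A *v w)"
  by (simp add: inner_matrix_transpose transpose_transpose flip: matrix_vector_mul_assoc)

lemma norm_matrix_vector_le_sigma_max:
  fixes A :: "real ^ 'n ^ 'm"
  shows "(norm (A *v v))\<^sup>2 \<le> sigma_max (transpose A ** A) * (norm v)\<^sup>2"
  using quadratic_form_le_sigma_max[of "transpose A ** A" v]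
  by (simp add: inner_gram power2_norm_eq_inner matrix_transpose_mul)

text \<open>A matrix and its transpose have the same operator norm: Cauchy-Schwarz bounds the square
  of \<open>u = transpose A *v w\<close> by \<open>norm w * norm (A *v u)\<close>, and after
  squaring one factor \<open>(norm u)\<^sup>2\<close> cancels.\<close>

lemma norm_transpose_matrix_vector_le:
  fixes A :: "real ^ 'n ^ 'm"
  assumes A: "\<And>v. (norm (A *v v))\<^sup>2 \<le> C * (norm v)\<^sup>2"
  shows "(norm (transpose A *v w))\<^sup>2 \<le> C * (norm w)\<^sup>2"
proof -
  define u where "u = transpose A *v w"
  have "(norm u)\<^sup>2 = w \<bullet> (A *v u)"
    by (simp add: inner_matrix_transpose u_def power2_norm_eq_inner)
  also have "\<dots> \<le> norm w * norm (A *v u)"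
    by (rule norm_cauchy_schwarz)
  finally have "((norm u)\<^sup>2)\<^sup>2 \<le> (norm w * norm (A *v u))\<^sup>2"
    by (intro power_mono) auto
  also have "\<dots> \<le> (norm w)\<^sup>2 * (C * (norm u)\<^sup>2)"
    unfolding power_mult_distrib by (intro mult_left_mono A) auto
  finally have *: "(norm u)\<^sup>2 * (norm u)\<^sup>2 \<le> (C * (norm w)\<^sup>2) * (norm u)\<^sup>2"
    by (simp add: power2_eq_square mult_ac)
  show ?thesis
  proof (cases "u = 0")
    case True
    \<comment> \<open>Nothing can be cancelled when \<open>u = 0\<close>; the sign of
      \<open>C\<close> is read off from the hypothesis at an arbitrary unit vector.\<close>
    have "0 \<le> C"
      using A[of "axis undefined 1"] order_trans[OF zero_le_power2] by (fastforce simp: norm_axis_1)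
    then show ?thesis using True by (simp add: u_def)
  next
    case False
    then have "0 < (norm u)\<^sup>2" by simp
    with * have "(norm u)\<^sup>2 \<le> C * (norm w)\<^sup>2" by (rule mult_right_le_imp_le)
    then show ?thesis unfolding u_def .
  qed
qed

section \<open>Strongly convex and smooth functions\<close>

lemma strongly_convex_smoothD:
  assumes "strongly_convex_smooth \<mu> L f f'"
  shows "\<mu> / 2 * (norm (\<theta> - \<theta>'))\<^sup>2 \<le> f \<theta> - f \<theta>' - f' \<theta>' \<bullet> (\<theta> - \<theta>')"
    and "f \<theta> - f \<theta>' - f' \<theta>' \<bullet> (\<theta> - \<theta>') \<le> L / 2 * (norm (\<theta> - \<theta>'))\<^sup>2"
  using assms unfolding strongly_convex_smooth_def by auto

text \<open>A gradient step of size \<open>1 / L\<close> lowers \<open>f\<close> by at least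
  \<open>(norm (f' \<theta>))\<^sup>2 / (2 * L)\<close> by smoothness, and it cannot go below
  \<open>m\<close>.\<close>

lemma norm_gradient_le_gap:
  assumes f: "strongly_convex_smooth \<mu> L f f'" and "0 < L" and "\<And>\<theta>. m \<le> f \<theta>"
  shows "(norm (f' \<theta>))\<^sup>2 \<le> 2 * L * (f \<theta> - m)"
proof -
  define n where "n = (norm (f' \<theta>))\<^sup>2"
  have "(norm (\<theta> - (1 / L) *\<^sub>R f' \<theta> - \<theta>))\<^sup>2 = (1 / L)\<^sup>2 * n"
    by (simp add: n_def power_divide)
  moreover have "f' \<theta> \<bullet> (\<theta> - (1 / L) *\<^sub>R f' \<theta> - \<theta>) = - (1 / L * n)"
    by (simp add: n_def power2_norm_eq_inner)
  ultimately have "f (\<theta> - (1 / L) *\<^sub>R f' \<theta>) - f \<theta> - - (1 / L * n) \<le> L / 2 * ((1 / L)\<^sup>2 * n)"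
    using strongly_convex_smoothD(2)[OF f, of "\<theta> - (1 / L) *\<^sub>R f' \<theta>" \<theta>] by (simp only:)
  moreover have "L / 2 * ((1 / L)\<^sup>2 * n) = n / (2 * L)" "1 / L * n = n / (2 * L) + n / (2 * L)"
    using \<open>0 < L\<close> by (simp_all add: power2_eq_square field_simps)
  ultimately have "n / (2 * L) \<le> f \<theta> - f (\<theta> - (1 / L) *\<^sub>R f' \<theta>)"
    by linarith
  also have "\<dots> \<le> f \<theta> - m" using assms(3) by simp
  finally show ?thesis using \<open>0 < L\<close> by (simp add: n_def field_simps)
qed

text \<open>The gap is zero at the minimiser, so the self-bounding inequality makes the gradient
  vanish there and the linear term drops out.\<close>

lemma gap_bounds_at_minimum:
  assumes f: "strongly_convex_smooth \<mu> L f f'" and "0 < L" and min: "\<And>\<theta>. f \<theta>\<^sub>0 \<le> f \<theta>"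
  shows "\<mu> / 2 * (norm (\<theta> - \<theta>\<^sub>0))\<^sup>2 \<le> f \<theta> - f \<theta>\<^sub>0"
    and "f \<theta> - f \<theta>\<^sub>0 \<le> L / 2 * (norm (\<theta> - \<theta>\<^sub>0))\<^sup>2"
proof -
  have "f' \<theta>\<^sub>0 = 0"
    using norm_gradient_le_gap[OF f \<open>0 < L\<close> min, of \<theta>\<^sub>0] by simp
  then show "\<mu> / 2 * (norm (\<theta> - \<theta>\<^sub>0))\<^sup>2 \<le> f \<theta> - f \<theta>\<^sub>0" "f \<theta> - f \<theta>\<^sub>0 \<le> L / 2 * (norm (\<theta> - \<theta>\<^sub>0))\<^sup>2"
    using strongly_convex_smoothD[OF f, of \<theta> \<theta>\<^sub>0] by auto
qed

text \<open>The lower bounds expanded at the intermediate point \<open>z\<close> towards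
  \<open>x\<close> and \<open>y\<close> are averaged with weights \<open>1 - s\<close> and
  \<open>s\<close>, which cancels the gradient. Being free of gradients, the result can be
  integrated over the parameter.\<close>

lemma strongly_convex_segment:
  assumes f: "strongly_convex_smooth \<mu> L f f'" and s: "0 \<le> s" "s \<le> 1"
  shows "f (x + s *\<^sub>R (y - x)) \<le> (1 - s) * f x + s * f y - s * (1 - s) * (\<mu> / 2 * (norm (y - x))\<^sup>2)"
proof -
  define z where "z = x + s *\<^sub>R (y - x)"
  define n where "n = (norm (y - x))\<^sup>2"
  define g where "g = f' z \<bullet> (y - x)"
  have xz: "x - z = (- s) *\<^sub>R (y - x)" and yz: "y - z = (1 - s) *\<^sub>R (y - x)"
    unfolding z_def by (simp_all add: algebra_simps)
  have "\<mu> / 2 * (s\<^sup>2 * n) \<le> f x - f z + s * g"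
    using strongly_convex_smoothD(1)[OF f, of x z]
    unfolding xz n_def g_def by (simp add: power_mult_distrib)
  then have 1: "(1 - s) * (\<mu> / 2 * (s\<^sup>2 * n)) \<le> (1 - s) * (f x - f z + s * g)"
    using s by (intro mult_left_mono) auto
  have "\<mu> / 2 * ((1 - s)\<^sup>2 * n) \<le> f y - f z - (1 - s) * g"
    using strongly_convex_smoothD(1)[OF f, of y z]
    unfolding yz n_def g_def by (simp add: power_mult_distrib)
  then have 2: "s * (\<mu> / 2 * ((1 - s)\<^sup>2 * n)) \<le> s * (f y - f z - (1 - s) * g)"
    using s by (intro mult_left_mono) auto
  have "(1 - s) * (\<mu> / 2 * (s\<^sup>2 * n)) + s * (\<mu> / 2 * ((1 - s)\<^sup>2 * n)) = s * (1 - s) * (\<mu> / 2 * n)"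
    by (simp add: power2_eq_square field_simps)
  moreover have "(1 - s) * (f x - f z + s * g) + s * (f y - f z - (1 - s) * g)
      = (1 - s) * f x + s * f y - f z"
    by (simp add: algebra_simps)
  ultimately have "f z \<le> (1 - s) * f x + s * f y - s * (1 - s) * (\<mu> / 2 * n)"
    using 1 2 by linarith
  then show ?thesis unfolding z_def n_def .
qed

text \<open>Convexity and smoothness enclose the quotient between two terms that differ from the
  limit by a constant times the increment. A limit along a sequence is what measurability of the
  gradient needs.\<close>

lemma gradient_difference_quotient:
  assumes f: "strongly_convex_smooth \<mu> L f f'"
  shows "(\<lambda>n. real (Suc n) * (f (\<theta> + inverse (real (Suc n)) *\<^sub>R e) - f \<theta>)) \<longlonglongrightarrow> f' \<theta> \<bullet> e"
proof -
  define s where "s n = inverse (real (Suc n))" for n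
  have s: "s n > 0" "real (Suc n) = 1 / s n" for n
    by (simp_all add: s_def field_simps)
  have lim: "(\<lambda>n. f' \<theta> \<bullet> e + s n * (m / 2 * (norm e)\<^sup>2)) \<longlonglongrightarrow> f' \<theta> \<bullet> e" for m
  proof -
    have "(\<lambda>n. f' \<theta> \<bullet> e + s n * (m / 2 * (norm e)\<^sup>2)) \<longlonglongrightarrow> f' \<theta> \<bullet> e + 0 * (m / 2 * (norm e)\<^sup>2)"
      unfolding s_def by (intro tendsto_intros LIMSEQ_inverse_real_of_nat)
    then show ?thesis by simp
  qed
  have "f' \<theta> \<bullet> e + s n * (\<mu> / 2 * (norm e)\<^sup>2) \<le> 1 / s n * (f (\<theta> + s n *\<^sub>R e) - f \<theta>)"
    and "1 / s n * (f (\<theta> + s n *\<^sub>R e) - f \<theta>) \<le> f' \<theta> \<bullet> e + s n * (L / 2 * (norm e)\<^sup>2)" for n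
  proof -
    have "(norm (\<theta> + s n *\<^sub>R e - \<theta>))\<^sup>2 = s n * s n * (norm e)\<^sup>2"
      "f' \<theta> \<bullet> (\<theta> + s n *\<^sub>R e - \<theta>) = s n * (f' \<theta> \<bullet> e)"
      by (simp_all add: power_mult_distrib) (simp add: power2_eq_square)
    with strongly_convex_smoothD[OF f, of "\<theta> + s n *\<^sub>R e" \<theta>]
    have "(f' \<theta> \<bullet> e + s n * (\<mu> / 2 * (norm e)\<^sup>2)) * s n \<le> f (\<theta> + s n *\<^sub>R e) - f \<theta>"
      "f (\<theta> + s n *\<^sub>R e) - f \<theta> \<le> (f' \<theta> \<bullet> e + s n * (L / 2 * (norm e)\<^sup>2)) * s n"
      by (simp_all only:) (simp_all add: algebra_simps)
    then show "f' \<theta> \<bullet> e + s n * (\<mu> / 2 * (norm e)\<^sup>2) \<le> 1 / s n * (f (\<theta> + s n *\<^sub>R e) - f \<theta>)"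
      and "1 / s n * (f (\<theta> + s n *\<^sub>R e) - f \<theta>) \<le> f' \<theta> \<bullet> e + s n * (L / 2 * (norm e)\<^sup>2)"
      using s(1)[of n] by (simp_all add: pos_le_divide_eq pos_divide_le_eq)
  qed
  then show ?thesis
    unfolding s_def[symmetric] s(2)
    by (intro tendsto_sandwich[OF _ _ lim[of \<mu>] lim[of L]] always_eventually) auto
qed

text \<open>The difference of the two sides is \<open>(norm (a - b))\<^sup>2\<close>.\<close>

lemma norm_add_power2_le:
  fixes a b :: "'a::real_inner"
  shows "(norm (a + b))\<^sup>2 \<le> 2 * (norm a)\<^sup>2 + 2 * (norm b)\<^sup>2"
  using inner_ge_zero[of "a - b"]
  by (simp add: power2_norm_eq_inner inner_add_left inner_add_right inner_diff_left inner_diff_right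
      inner_commute[of b a])

section \<open>Measurability and independence\<close>

text \<open>Replacing \<open>X\<close> by simple functions leaves only finitely many values of the
  first argument, where \<open>meas\<close> suffices; continuity in that argument carries
  measurability to the limit. No joint measurability of \<open>f\<close> is assumed.\<close>

lemma borel_measurable_Caratheodory:
  fixes f :: "'a::{metric_space, second_countable_topology} \<Rightarrow> 'b \<Rightarrow> real"
  assumes X: "X \<in> borel_measurable N" and Y: "Y \<in> measurable N M"
    and meas: "\<And>\<theta>. f \<theta> \<in> borel_measurable M"
    and cont: "\<And>l \<theta>. l \<in> space M \<Longrightarrow> isCont (\<lambda>\<theta>. f \<theta> l) \<theta>"
  shows "(\<lambda>x. f (X x) (Y x)) \<in> borel_measurable N"
proof -
  obtain F where F: "\<And>i. simple_function N (F i)"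
    and lim: "\<And>x. x \<in> space N \<Longrightarrow> (\<lambda>i. F i x) \<longlonglongrightarrow> X x"
    using borel_measurable_implies_sequence_metric[OF X, of undefined] by metis
  show ?thesis
  proof (rule borel_measurable_LIMSEQ_real)
    fix i
    show "(\<lambda>x. f (F i x) (Y x)) \<in> borel_measurable N"
    proof (rule measurable_compose_countable'[where I = "F i ` space N"])
      show "(\<lambda>x. f \<theta> (Y x)) \<in> borel_measurable N" for \<theta>
        using Y meas by (rule measurable_compose)
      show "F i \<in> measurable N (count_space (F i ` space N))"
        using F by (auto simp: simple_function_def measurable_count_space_eq2)
      show "countable (F i ` space N)"
        using F by (auto simp: simple_function_def intro: countable_finite)
    qed
  next
    fix x assume x: "x \<in> space N"
    then have "Y x \<in> space M" using Y by (rule measurable_space[rotated])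
    from isCont_tendsto_compose[OF cont[OF this] lim[OF x]]
    show "(\<lambda>i. f (F i x) (Y x)) \<longlonglongrightarrow> f (X x) (Y x)" .
  qed
qed

lemma borel_measurable_transpose [measurable (raw)]:
  fixes A :: "'a \<Rightarrow> real ^ 'n ^ 'm"
  assumes "A \<in> borel_measurable N"
  shows "(\<lambda>x. transpose (A x)) \<in> borel_measurable N"
proof -
  have "continuous_on UNIV (transpose :: real ^ 'n ^ 'm \<Rightarrow> _)"
    unfolding transpose_def by (intro continuous_intros)
  from measurable_compose[OF assms borel_measurable_continuous_onI[OF this]] show ?thesis .
qed

lemma borel_measurable_matrix_vector_mult [measurable (raw)]:
  fixes A :: "'a \<Rightarrow> real ^ 'n ^ 'm"
  assumes "A \<in> borel_measurable N" "v \<in> borel_measurable N"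
  shows "(\<lambda>x. A x *v v x) \<in> borel_measurable N"
proof (rule borel_measurable_continuous_Pair[OF assms])
  show "continuous_on UNIV (\<lambda>x. fst x *v snd x :: real ^ 'm)"
    unfolding matrix_vector_mult_def by (intro continuous_intros)
qed

lemma borel_measurable_matrix_mult [measurable (raw)]:
  fixes A :: "'a \<Rightarrow> real ^ 'n ^ 'm" and B :: "'a \<Rightarrow> real ^ 'k ^ 'n"
  assumes "A \<in> borel_measurable N" "B \<in> borel_measurable N"
  shows "(\<lambda>x. A x ** B x) \<in> borel_measurable N"
proof (rule borel_measurable_continuous_Pair[OF assms])
  show "continuous_on UNIV (\<lambda>x. fst x ** snd x :: real ^ 'k ^ 'm)"
    unfolding matrix_matrix_mult_def by (intro continuous_intros)
qed

text \<open>Measurability of \<open>f'\<close> is derived rather than assumed: each component is a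
  pointwise limit of difference quotients of \<open>f\<close>.\<close>

lemma borel_measurable_gradient:
  fixes f :: "real ^ 'd \<Rightarrow> 'b \<Rightarrow> real"
  assumes X: "X \<in> borel_measurable N" and Y: "Y \<in> measurable N M"
    and meas: "\<And>\<theta>. f \<theta> \<in> borel_measurable M"
    and cont: "\<And>l \<theta>. l \<in> space M \<Longrightarrow> isCont (\<lambda>\<theta>. f \<theta> l) \<theta>"
    and f: "\<And>l. l \<in> space M \<Longrightarrow> strongly_convex_smooth \<mu> L (\<lambda>\<theta>. f \<theta> l) (\<lambda>\<theta>. f' \<theta> l)"
  shows "(\<lambda>x. f' (X x) (Y x)) \<in> borel_measurable N"
proof (subst borel_measurable_euclidean_space, rule ballI)
  fix e :: "real ^ 'd"
  note [measurable] = X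
  show "(\<lambda>x. f' (X x) (Y x) \<bullet> e) \<in> borel_measurable N"
  proof (rule borel_measurable_LIMSEQ_real)
    fix x assume "x \<in> space N"
    then have "Y x \<in> space M" using Y by (rule measurable_space[rotated])
    from gradient_difference_quotient[OF f[OF this], of "X x" e]
    show "(\<lambda>n. real (Suc n) * (f (X x + inverse (real (Suc n)) *\<^sub>R e) (Y x) - f (X x) (Y x)))
        \<longlonglongrightarrow> f' (X x) (Y x) \<bullet> e" .
  next
    fix n
    have "(\<lambda>x. f (X x + inverse (real (Suc n)) *\<^sub>R e) (Y x)) \<in> borel_measurable N"
      "(\<lambda>x. f (X x) (Y x)) \<in> borel_measurable N"
      using X by (auto intro!: borel_measurable_Caratheodory[OF _ Y meas cont])
    then show "(\<lambda>x. real (Suc n) * (f (X x + inverse (real (Suc n)) *\<^sub>R e) (Y x) - f (X x) (Y x)))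
        \<in> borel_measurable N"
      by measurable
  qed
qed

text \<open>Independence makes the joint law a product, so Tonelli applies. This stands in for
  conditioning on \<open>X\<close>.\<close>

lemma (in prob_space) nn_integral_indep_var:
  assumes indep: "indep_var S X T Y" and G: "G \<in> borel_measurable (S \<Otimes>\<^sub>M T)"
  shows "(\<integral>\<^sup>+\<omega>. G (X \<omega>, Y \<omega>) \<partial>M) = (\<integral>\<^sup>+\<omega>. (\<integral>\<^sup>+y. G (X \<omega>, y) \<partial>distr M T Y) \<partial>M)"
proof -
  from indep have X [measurable]: "X \<in> measurable M S" and Y [measurable]: "Y \<in> measurable M T"
    and eq: "distr M S X \<Otimes>\<^sub>M distr M T Y = distr M (S \<Otimes>\<^sub>M T) (\<lambda>\<omega>. (X \<omega>, Y \<omega>))"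
    unfolding indep_var_distribution_eq by auto
  interpret Y: prob_space "distr M T Y" by (rule prob_space_distr) fact
  have G' [measurable]: "G \<in> borel_measurable (S \<Otimes>\<^sub>M distr M T Y)"
    using G by (simp cong: measurable_cong_sets)
  have G'' [measurable]: "G \<in> borel_measurable (distr M S X \<Otimes>\<^sub>M distr M T Y)"
    using G by (simp cong: measurable_cong_sets)
  have "(\<integral>\<^sup>+\<omega>. G (X \<omega>, Y \<omega>) \<partial>M) = (\<integral>\<^sup>+z. G z \<partial>distr M (S \<Otimes>\<^sub>M T) (\<lambda>\<omega>. (X \<omega>, Y \<omega>)))"
    using G by (subst nn_integral_distr) auto
  also have "\<dots> = (\<integral>\<^sup>+x. (\<integral>\<^sup>+y. G (x, y) \<partial>distr M T Y) \<partial>distr M S X)"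
    unfolding eq[symmetric] by (rule Y.nn_integral_fst[symmetric]) fact
  also have "\<dots> = (\<integral>\<^sup>+\<omega>. (\<integral>\<^sup>+y. G (X \<omega>, y) \<partial>distr M T Y) \<partial>M)"
    by (intro nn_integral_distr X Y.borel_measurable_nn_integral) (simp add: case_prod_beta')
  finally show ?thesis .
qed

section \<open>Average objective and solution path error\<close>

text \<open>\<open>space M\<close> plays the role of the parameter set \<Lambda>, so bounds hold at
  every parameter and not just almost surely. Step size and samples are supplied lemma by
  lemma.\<close>

locale solution_path_sgd = prob_space M
  for M :: "'l measure" +
  fixes h :: "real ^ 'd \<Rightarrow> 'l \<Rightarrow> real"
    and gradh :: "real ^ 'd \<Rightarrow> 'l \<Rightarrow> real ^ 'd"
    and \<theta>opt :: "'l \<Rightarrow> real ^ 'd"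
    and \<Phi> :: "'l \<Rightarrow> real ^ 'p ^ 'd"
    and \<beta>avg :: "real ^ 'p"
    and \<mu> L C c :: real
  assumes h_meas: "\<And>\<theta>. h \<theta> \<in> borel_measurable M"
    and \<Phi>_meas [measurable]: "\<Phi> \<in> borel_measurable M"
    and h_integrable: "\<And>\<beta>. integrable M (\<lambda>l. h (\<Phi> l *v \<beta>) l)"
    and \<theta>opt: "\<And>l \<theta>. l \<in> space M \<Longrightarrow> h (\<theta>opt l) l \<le> h \<theta> l"
    and grad: "\<And>l \<theta>. l \<in> space M \<Longrightarrow> GDERIV (\<lambda>\<theta>'. h \<theta>' l) \<theta> :> gradh \<theta> l"
    and C_finite: "bdd_above ((\<lambda>l. sigma_max (transpose (\<Phi> l) ** \<Phi> l)) ` space M)"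
    and C: "C = (SUP l\<in>space M. sigma_max (transpose (\<Phi> l) ** \<Phi> l))"
    and c: "c = sigma_min (\<integral>l. transpose (\<Phi> l) ** \<Phi> l \<partial>M)"
    and \<beta>avg: "\<And>\<beta>. (\<integral>l. h (\<Phi> l *v \<beta>avg) l \<partial>M) \<le> (\<integral>l. h (\<Phi> l *v \<beta>) l \<partial>M)"
    and \<mu>L: "0 < \<mu>" "\<mu> \<le> L"
    and convex_smooth:
      "\<And>l. l \<in> space M \<Longrightarrow> strongly_convex_smooth \<mu> L (\<lambda>\<theta>. h \<theta> l) (\<lambda>\<theta>. gradh \<theta> l)"
    and indep_basis: "\<not> (\<exists>\<beta>. \<beta> \<noteq> 0 \<and> (AE l in M. \<Phi> l *v \<beta> = 0))"
begin

lemma L_pos: "0 < L"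
  using \<mu>L by simp

lemma isCont_h: "l \<in> space M \<Longrightarrow> isCont (\<lambda>\<theta>. h \<theta> l) \<theta>"
  using grad[of l \<theta>] unfolding gderiv_def by (rule has_derivative_continuous)

lemma borel_measurable_gradh:
  assumes "X \<in> borel_measurable N" "Y \<in> measurable N M"
  shows "(\<lambda>x. gradh (X x) (Y x)) \<in> borel_measurable N"
  using assms h_meas isCont_h convex_smooth by (rule borel_measurable_gradient)

lemma norm_\<Phi>_le: "(norm (\<Phi> l *v v))\<^sup>2 \<le> C * (norm v)\<^sup>2" if "l \<in> space M"
proof -
  have "sigma_max (transpose (\<Phi> l) ** \<Phi> l) \<le> C"
    unfolding C using that C_finite by (rule cSUP_upper)
  then have "sigma_max (transpose (\<Phi> l) ** \<Phi> l) * (norm v)\<^sup>2 \<le> C * (norm v)\<^sup>2"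
    by (rule mult_right_mono) simp
  with norm_matrix_vector_le_sigma_max show ?thesis by (rule order_trans)
qed

text \<open>The entries of the Gram matrix are inner products of columns of \<open>\<Phi> l\<close>,
  each of norm at most \<open>sqrt C\<close>; hence the matrix is bounded. Integrability lets linear
  forms pass through the integral defining \<open>c\<close>.\<close>

lemma integrable_gram: "integrable M (\<lambda>l. transpose (\<Phi> l) ** \<Phi> l)"
proof (rule integrable_const_bound)
  show "AE l in M. norm (transpose (\<Phi> l) ** \<Phi> l) \<le> (\<Sum>i\<in>(UNIV :: 'p set). \<Sum>j\<in>(UNIV :: 'p set). C)"
  proof (rule AE_I2)
    fix l assume l: "l \<in> space M"
    let ?G = "transpose (\<Phi> l) ** \<Phi> l"
    have axis: "norm (\<Phi> l *v axis i 1) \<le> sqrt C" for i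
      using norm_\<Phi>_le[OF l, of "axis i 1"] by (simp add: real_le_rsqrt)
    have entry: "\<bar>?G $ i $ j\<bar> \<le> C" for i j
    proof -
      have "?G $ i $ j = axis i 1 \<bullet> (?G *v axis j 1)"
        by (simp add: inner_axis' matrix_vector_mul_component matrix_vector_mult_basis column_def)
      also have "\<dots> = (\<Phi> l *v axis i 1) \<bullet> (\<Phi> l *v axis j 1)"
        by (rule inner_gram)
      finally have "\<bar>?G $ i $ j\<bar> \<le> norm (\<Phi> l *v axis i 1) * norm (\<Phi> l *v axis j 1)"
        by (simp add: Cauchy_Schwarz_ineq2)
      also have "\<dots> \<le> sqrt C * sqrt C"
        using axis order_trans[OF norm_ge_zero axis] by (intro mult_mono) auto
      also have "\<dots> = C"
        using order_trans[OF norm_ge_zero axis] by simp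
      finally show ?thesis .
    qed
    have "norm ?G \<le> (\<Sum>i\<in>UNIV. norm (?G $ i))"
      unfolding norm_vec_def by (rule L2_set_le_sum) simp
    also have "\<dots> \<le> (\<Sum>i\<in>UNIV. \<Sum>j\<in>UNIV. \<bar>?G $ i $ j\<bar>)"
      by (intro sum_mono norm_le_l1_cart)
    also have "\<dots> \<le> (\<Sum>i\<in>(UNIV :: 'p set). \<Sum>j\<in>(UNIV :: 'p set). C)"
      by (intro sum_mono entry)
    finally show "norm ?G \<le> (\<Sum>i\<in>(UNIV :: 'p set). \<Sum>j\<in>(UNIV :: 'p set). C)" .
  qed
qed measurable

lemma bounded_linear_quadratic_form: "bounded_linear (\<lambda>A :: real ^ 'p ^ 'p. v \<bullet> (A *v v))"
  by (intro linear_conv_bounded_linear[THEN iffD1] linearI)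
    (simp_all add: matrix_vector_mult_add_rdistrib inner_add_right flip: scaleR_matrix_vector_assoc)

lemma norm_\<Phi>_eq: "(norm (\<Phi> l *v v))\<^sup>2 = v \<bullet> ((transpose (\<Phi> l) ** \<Phi> l) *v v)"
  by (simp add: inner_gram power2_norm_eq_inner)

lemma integrable_norm_\<Phi>: "integrable M (\<lambda>l. (norm (\<Phi> l *v v))\<^sup>2)"
  unfolding norm_\<Phi>_eq by (rule integrable_bounded_linear[OF bounded_linear_quadratic_form integrable_gram])

lemma integral_norm_\<Phi>:
  "(\<integral>l. (norm (\<Phi> l *v v))\<^sup>2 \<partial>M) = v \<bullet> ((\<integral>l. transpose (\<Phi> l) ** \<Phi> l \<partial>M) *v v)"
  unfolding norm_\<Phi>_eq by (rule integral_bounded_linear[OF bounded_linear_quadratic_form integrable_gram])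

lemma transpose_integral_gram:
  "transpose (\<integral>l. transpose (\<Phi> l) ** \<Phi> l \<partial>M) = (\<integral>l. transpose (\<Phi> l) ** \<Phi> l \<partial>M)"
proof -
  have "bounded_linear (transpose :: real ^ 'p ^ 'p \<Rightarrow> _)"
    by (intro linear_conv_bounded_linear[THEN iffD1] linearI) (simp_all add: transpose_def vec_eq_iff)
  from integral_bounded_linear[OF this integrable_gram] show ?thesis
    by (simp add: matrix_transpose_mul)
qed

lemma integral_norm_\<Phi>_ge: "c * (norm v)\<^sup>2 \<le> (\<integral>l. (norm (\<Phi> l *v v))\<^sup>2 \<partial>M)"
  unfolding integral_norm_\<Phi> c by (rule sigma_min_le_quadratic_form[OF transpose_integral_gram])

text \<open>For an eigenvector \<open>v\<close> of the eigenvalue \<open>c\<close>, the mean of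
  \<open>(norm (\<Phi> l *v v))\<^sup>2\<close> is \<open>c * (v \<bullet> v)\<close>. Were it zero,
  \<open>\<Phi> l *v v\<close> would vanish almost everywhere, against
  \<open>indep_basis\<close>.\<close>

lemma c_pos: "0 < c"
proof -
  obtain v where v: "v \<noteq> 0" "(\<integral>l. transpose (\<Phi> l) ** \<Phi> l \<partial>M) *v v = c *\<^sub>R v"
    using sigma_min_in_eigenvalues[OF transpose_integral_gram] unfolding eigenvalues_def c by blast
  have "(\<integral>l. (norm (\<Phi> l *v v))\<^sup>2 \<partial>M) \<noteq> 0"
  proof
    assume "(\<integral>l. (norm (\<Phi> l *v v))\<^sup>2 \<partial>M) = 0"
    then have "AE l in M. (norm (\<Phi> l *v v))\<^sup>2 = 0"
      by (subst (asm) integral_nonneg_eq_0_iff_AE) (auto simp: integrable_norm_\<Phi>)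
    with v indep_basis show False by auto
  qed
  moreover have "0 \<le> (\<integral>l. (norm (\<Phi> l *v v))\<^sup>2 \<partial>M)"
    by (rule Bochner_Integration.integral_nonneg) simp
  ultimately have "0 < (\<integral>l. (norm (\<Phi> l *v v))\<^sup>2 \<partial>M)"
    by linarith
  then have "0 < c * (v \<bullet> v)"
    by (simp add: integral_norm_\<Phi> v)
  with v show ?thesis using zero_less_mult_pos2[of c "v \<bullet> v"] by simp
qed

text \<open>At a unit vector the mean bound from below meets the pointwise bound from above. This
  later keeps the contraction factor nonnegative and merges constants.\<close>

lemma c_le_C: "c \<le> C"
proof -
  let ?v = "axis undefined 1 :: real ^ 'p"
  have "c * (norm ?v)\<^sup>2 \<le> (\<integral>l. (norm (\<Phi> l *v ?v))\<^sup>2 \<partial>M)"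
    by (rule integral_norm_\<Phi>_ge)
  also have "\<dots> \<le> (\<integral>l. C * (norm ?v)\<^sup>2 \<partial>M)"
    by (intro integral_mono integrable_norm_\<Phi> norm_\<Phi>_le) auto
  finally show ?thesis by (simp add: norm_axis_1 prob_space)
qed

lemma C_pos: "0 < C"
  using c_pos c_le_C by simp

text \<open>Comparing with the points \<open>\<beta>avg + s (\<beta> - \<beta>avg)\<close> and letting \<open>s\<close> tend to 0 avoids
  differentiating under the integral.\<close>

lemma average_growth:
  "c * \<mu> / 2 * (norm (\<beta> - \<beta>avg))\<^sup>2 \<le> (\<integral>l. h (\<Phi> l *v \<beta>) l \<partial>M) - (\<integral>l. h (\<Phi> l *v \<beta>avg) l \<partial>M)"
proof -
  define f where "f x = (\<integral>l. h (\<Phi> l *v x) l \<partial>M)" for x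
  define q where "q = \<mu> / 2 * (\<integral>l. (norm (\<Phi> l *v (\<beta> - \<beta>avg)))\<^sup>2 \<partial>M)"
  have int: "integrable M (\<lambda>l. h (\<Phi> l *v x) l)" for x by (rule h_integrable)
  have "(1 - s) * q \<le> f \<beta> - f \<beta>avg" if s: "0 < s" "s < 1" for s
  proof -
    have "f (\<beta>avg + s *\<^sub>R (\<beta> - \<beta>avg)) \<le> (\<integral>l. (1 - s) * h (\<Phi> l *v \<beta>avg) l + s * h (\<Phi> l *v \<beta>) l
        - s * (1 - s) * (\<mu> / 2 * (norm (\<Phi> l *v (\<beta> - \<beta>avg)))\<^sup>2) \<partial>M)"
      unfolding f_def
    proof (rule integral_mono)
      fix l assume "l \<in> space M"
      have eq: "\<Phi> l *v (\<beta>avg + s *\<^sub>R (\<beta> - \<beta>avg)) = \<Phi> l *v \<beta>avg + s *\<^sub>R (\<Phi> l *v \<beta> - \<Phi> l *v \<beta>avg)"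
        "\<Phi> l *v (\<beta> - \<beta>avg) = \<Phi> l *v \<beta> - \<Phi> l *v \<beta>avg"
        by (simp_all add: matrix_vector_right_distrib matrix_vector_mult_scaleR
            matrix_vector_mult_diff_distrib)
      show "h (\<Phi> l *v (\<beta>avg + s *\<^sub>R (\<beta> - \<beta>avg))) l \<le> (1 - s) * h (\<Phi> l *v \<beta>avg) l
        + s * h (\<Phi> l *v \<beta>) l - s * (1 - s) * (\<mu> / 2 * (norm (\<Phi> l *v (\<beta> - \<beta>avg)))\<^sup>2)"
        unfolding eq using strongly_convex_segment[OF convex_smooth[OF \<open>l \<in> space M\<close>]] s by simp
    qed (intro Bochner_Integration.integrable_add Bochner_Integration.integrable_diff
        integrable_mult_right int integrable_norm_\<Phi>)+
    also have "\<dots> = (1 - s) * f \<beta>avg + s * f \<beta> - s * (1 - s) * q"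
    proof -
      have "integrable M (\<lambda>l. (1 - s) * h (\<Phi> l *v \<beta>avg) l)" "integrable M (\<lambda>l. s * h (\<Phi> l *v \<beta>) l)"
        "integrable M (\<lambda>l. s * (1 - s) * (\<mu> / 2 * (norm (\<Phi> l *v (\<beta> - \<beta>avg)))\<^sup>2))"
        by (rule integrable_mult_right, rule int)+
          (rule integrable_mult_right, rule integrable_mult_right, rule integrable_norm_\<Phi>)
      then show ?thesis unfolding f_def q_def by simp
    qed
    \<comment> \<open>Minimality puts \<open>f \<beta>avg\<close> below the value at the
      intermediate point; a factor \<open>s\<close> can then be divided out, leaving
      \<open>1 - s\<close>, which tends to 1.\<close>
    finally have "s * ((1 - s) * q) \<le> s * (f \<beta> - f \<beta>avg)"
      using \<beta>avg[of "\<beta>avg + s *\<^sub>R (\<beta> - \<beta>avg)"] unfolding f_def by (simp add: algebra_simps)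
    with s show ?thesis by simp
  qed
  then have "eventually (\<lambda>s. (1 - s) * q \<le> f \<beta> - f \<beta>avg) (at_right 0)"
    by (intro eventually_at_rightI[of 0 1]) auto
  moreover have "((\<lambda>s. (1 - s) * q) \<longlongrightarrow> (1 - 0) * q) (at_right 0)"
    by (intro tendsto_intros)
  ultimately have "q \<le> f \<beta> - f \<beta>avg"
    using tendsto_upperbound[of "\<lambda>s. (1 - s) * q" "(1 - 0) * q" "at_right 0"] by simp
  moreover have "\<mu> / 2 * (c * (norm (\<beta> - \<beta>avg))\<^sup>2) \<le> q"
    unfolding q_def using \<mu>L integral_norm_\<Phi>_ge by (intro mult_left_mono) auto
  ultimately show ?thesis unfolding f_def by (simp add: mult_ac)
qed

lemma gap_le_sp_error:
  assumes "sp_error (space M) h \<theta>opt \<Phi> \<beta> \<le> ereal e" "l \<in> space M"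
  shows "h (\<Phi> l *v \<beta>) l - h (\<theta>opt l) l \<le> e"
  using assms unfolding sp_error_def by (simp add: SUP_le_iff)

lemma sp_error_bound_nonneg:
  assumes "sp_error (space M) h \<theta>opt \<Phi> \<beta> \<le> ereal e"
  shows "0 \<le> e"
proof -
  obtain l where "l \<in> space M" using not_empty by blast
  with gap_le_sp_error[OF assms this] \<theta>opt[of l "\<Phi> l *v \<beta>"] show ?thesis by simp
qed

text \<open>Pointwise, \<open>\<beta>'s\<close> objective exceeds the optimum by at most
  \<open>e\<close>, hence exceeds that of \<open>\<beta>avg\<close> by at most \<open>e\<close>.
  Averaging and quadratic growth turn this excess into a distance;
  \<open>h (\<theta>opt l) l\<close> itself is never integrated.\<close>

lemma dist_average_minimiser:
  assumes e: "sp_error (space M) h \<theta>opt \<Phi> \<beta> \<le> ereal e"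
  shows "(norm (\<beta> - \<beta>avg))\<^sup>2 \<le> 2 * e / (c * \<mu>)"
proof -
  have "(\<integral>l. h (\<Phi> l *v \<beta>) l \<partial>M) \<le> (\<integral>l. h (\<Phi> l *v \<beta>avg) l + e \<partial>M)"
  proof (rule integral_mono)
    fix l assume l: "l \<in> space M"
    show "h (\<Phi> l *v \<beta>) l \<le> h (\<Phi> l *v \<beta>avg) l + e"
      using gap_le_sp_error[OF e l] \<theta>opt[OF l, of "\<Phi> l *v \<beta>avg"] by linarith
  qed (auto intro: h_integrable)
  also have "\<dots> = (\<integral>l. h (\<Phi> l *v \<beta>avg) l \<partial>M) + e"
    by (simp add: h_integrable prob_space)
  finally have "c * \<mu> / 2 * (norm (\<beta> - \<beta>avg))\<^sup>2 \<le> e"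
    using average_growth[of \<beta>] by linarith
  moreover have "0 < c * \<mu>" using c_pos \<mu>L by simp
  ultimately show ?thesis by (simp add: pos_le_divide_eq mult_ac)
qed

text \<open>The distance to \<open>\<theta>opt l\<close> is split at
  \<open>\<Phi> l *v \<beta>'\<close>, and the distance from \<open>\<beta>\<close> to
  \<open>\<beta>'\<close> at \<open>\<beta>avg\<close>. Each split costs a factor 2, which with
  \<open>L / 2\<close> gives the coefficient \<open>2 * C * L\<close>.\<close>

lemma sp_error_le:
  assumes e: "sp_error (space M) h \<theta>opt \<Phi> \<beta>' \<le> ereal e"
  shows "sp_error (space M) h \<theta>opt \<Phi> \<beta>
    \<le> ereal (2 * C * L * (norm (\<beta> - \<beta>avg))\<^sup>2 + 6 * C * L / (c * \<mu>) * e)"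
  unfolding sp_error_def
proof (rule SUP_least, subst ereal_less_eq(3))
  fix l assume l: "l \<in> space M"
  note e0 = sp_error_bound_nonneg[OF e]
  define D where "D = (norm (\<beta> - \<beta>avg))\<^sup>2"
  have "(norm (\<Phi> l *v \<beta>' - \<theta>opt l))\<^sup>2 * (\<mu> / 2) \<le> e"
    using gap_bounds_at_minimum(1)[OF convex_smooth[OF l] L_pos \<theta>opt[OF l], of "\<Phi> l *v \<beta>'"]
      gap_le_sp_error[OF e l] by (simp add: mult_ac)
  then have b: "(norm (\<Phi> l *v \<beta>' - \<theta>opt l))\<^sup>2 \<le> 2 * e / \<mu>"
    using \<mu>L by (simp add: pos_le_divide_eq)
  have "(norm (\<beta> - \<beta>'))\<^sup>2 \<le> 2 * D + 2 * (norm (\<beta>' - \<beta>avg))\<^sup>2"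
    using norm_add_power2_le[of "\<beta> - \<beta>avg" "\<beta>avg - \<beta>'"] by (simp add: D_def norm_minus_commute)
  also have "\<dots> \<le> 2 * D + 2 * (2 * e / (c * \<mu>))"
    using dist_average_minimiser[OF e] by (intro add_left_mono mult_left_mono) auto
  finally have "C * (norm (\<beta> - \<beta>'))\<^sup>2 \<le> C * (2 * D + 2 * (2 * e / (c * \<mu>)))"
    using C_pos by (intro mult_left_mono) auto
  with norm_\<Phi>_le[OF l] have a: "(norm (\<Phi> l *v (\<beta> - \<beta>')))\<^sup>2 \<le> C * (2 * D + 2 * (2 * e / (c * \<mu>)))"
    by (rule order_trans)
  have "(norm (\<Phi> l *v \<beta> - \<theta>opt l))\<^sup>2
      \<le> 2 * (norm (\<Phi> l *v (\<beta> - \<beta>')))\<^sup>2 + 2 * (norm (\<Phi> l *v \<beta>' - \<theta>opt l))\<^sup>2"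
    using norm_add_power2_le[of "\<Phi> l *v (\<beta> - \<beta>')" "\<Phi> l *v \<beta>' - \<theta>opt l"]
    by (simp add: matrix_vector_mult_diff_distrib)
  also have "\<dots> \<le> 2 * (C * (2 * D + 2 * (2 * e / (c * \<mu>)))) + 2 * (2 * e / \<mu>)"
    using a b by (intro add_mono mult_left_mono) auto
  finally have "L / 2 * (norm (\<Phi> l *v \<beta> - \<theta>opt l))\<^sup>2
      \<le> L / 2 * (2 * (C * (2 * D + 2 * (2 * e / (c * \<mu>)))) + 2 * (2 * e / \<mu>))"
    using L_pos by (intro mult_left_mono) auto
  also have "\<dots> = 2 * C * L * D + (4 * C * L / (c * \<mu>) + 2 * L / \<mu>) * e"
    by (simp add: algebra_simps)
  \<comment> \<open>The part \<open>2 * L / \<mu>\<close> is absorbed using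
    \<open>c \<le> C\<close>, turning 4 into 6.\<close>
  also have "\<dots> \<le> 2 * C * L * D + 6 * C * L / (c * \<mu>) * e"
  proof -
    have "2 * L / \<mu> = 2 * c * L / (c * \<mu>)"
      using c_pos by simp
    also have "\<dots> \<le> 2 * C * L / (c * \<mu>)"
      using c_pos c_le_C \<mu>L by (intro divide_right_mono mult_right_mono mult_left_mono) auto
    also have "\<dots> = 6 * C * L / (c * \<mu>) - 4 * C * L / (c * \<mu>)"
      by (simp flip: diff_divide_distrib)
    finally have "4 * C * L / (c * \<mu>) + 2 * L / \<mu> \<le> 6 * C * L / (c * \<mu>)"
      by (simp only: le_diff_eq add.commute)
    then show ?thesis
      using e0 by (intro add_left_mono mult_right_mono) auto
  qed
  finally show "h (\<Phi> l *v \<beta>) l - h (\<theta>opt l) l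
      \<le> 2 * C * L * (norm (\<beta> - \<beta>avg))\<^sup>2 + 6 * C * L / (c * \<mu>) * e"
    using gap_bounds_at_minimum(2)[OF convex_smooth[OF l] L_pos \<theta>opt[OF l], of "\<Phi> l *v \<beta>"]
    unfolding D_def by linarith
qed

section \<open>Stochastic gradient descent\<close>

lemma sgd_cong: "(\<And>k. k < t \<Longrightarrow> s k = s' k) \<Longrightarrow> sgd \<eta> \<Phi> g \<beta>0 s t = sgd \<eta> \<Phi> g \<beta>0 s' t"
  by (induction t) (simp_all add: Let_def)

definition sgd_step :: "real \<Rightarrow> real ^ 'p \<Rightarrow> 'l \<Rightarrow> real ^ 'p" where
  "sgd_step \<eta> \<beta> l = \<beta> - \<eta> *\<^sub>R (transpose (\<Phi> l) *v gradh (\<Phi> l *v \<beta>) l)"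

lemma sgd_Suc: "sgd \<eta> \<Phi> gradh \<beta>0 s (Suc t) = sgd_step \<eta> (sgd \<eta> \<Phi> gradh \<beta>0 s t) (s t)"
  by (simp add: sgd_step_def Let_def)

text \<open>Self-bounding of the gradient by the gap to \<open>h (\<theta>opt l) l\<close>; the latter need not be
  measurable in \<open>l\<close> and is therefore replaced by the lower bound \<open>h (\<Phi> l *v \<beta>') l - e\<close>.\<close>

lemma norm_sgd_step_le:
  assumes e: "sp_error (space M) h \<theta>opt \<Phi> \<beta>' \<le> ereal e" and l: "l \<in> space M" and \<eta>: "0 \<le> \<eta>"
  shows "(norm (sgd_step \<eta> \<beta> l - \<beta>avg))\<^sup>2 \<le> (norm (\<beta> - \<beta>avg))\<^sup>2
    - 2 * \<eta> * (h (\<Phi> l *v \<beta>) l - h (\<Phi> l *v \<beta>avg) l + \<mu> / 2 * (norm (\<Phi> l *v (\<beta> - \<beta>avg)))\<^sup>2)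
    + 2 * \<eta>\<^sup>2 * C * L * (h (\<Phi> l *v \<beta>) l - h (\<Phi> l *v \<beta>') l + e)"
proof -
  define d where "d = gradh (\<Phi> l *v \<beta>) l"
  define g where "g = transpose (\<Phi> l) *v d"
  have "(norm (sgd_step \<eta> \<beta> l - \<beta>avg))\<^sup>2 = (norm ((\<beta> - \<beta>avg) - \<eta> *\<^sub>R g))\<^sup>2"
    unfolding sgd_step_def g_def d_def by (simp add: algebra_simps)
  also have "\<dots> = (norm (\<beta> - \<beta>avg))\<^sup>2 - 2 * \<eta> * (g \<bullet> (\<beta> - \<beta>avg)) + \<eta>\<^sup>2 * (norm g)\<^sup>2"
  proof -
    have "(norm (x - \<eta> *\<^sub>R g))\<^sup>2 = (norm x)\<^sup>2 - 2 * \<eta> * (g \<bullet> x) + \<eta>\<^sup>2 * (norm g)\<^sup>2" for x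
      unfolding power2_norm_eq_inner
      by (simp add: inner_diff_left inner_diff_right inner_commute[of x g] power2_eq_square
          algebra_simps)
    then show ?thesis .
  qed
  finally have 1: "(norm (sgd_step \<eta> \<beta> l - \<beta>avg))\<^sup>2
      = (norm (\<beta> - \<beta>avg))\<^sup>2 - 2 * \<eta> * (g \<bullet> (\<beta> - \<beta>avg)) + \<eta>\<^sup>2 * (norm g)\<^sup>2" .
  have "g \<bullet> (\<beta> - \<beta>avg) = d \<bullet> (\<Phi> l *v (\<beta> - \<beta>avg))"
    unfolding g_def by (rule inner_matrix_transpose[symmetric])
  \<comment> \<open>The expansion is at the current point and evaluated at
    \<open>\<beta>avg\<close>; the quadratic term it keeps is the source of the contraction.\<close>
  moreover have "\<mu> / 2 * (norm (\<Phi> l *v \<beta>avg - \<Phi> l *v \<beta>))\<^sup>2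
      \<le> h (\<Phi> l *v \<beta>avg) l - h (\<Phi> l *v \<beta>) l - d \<bullet> (\<Phi> l *v \<beta>avg - \<Phi> l *v \<beta>)"
    unfolding d_def by (rule strongly_convex_smoothD(1)[OF convex_smooth[OF l]])
  ultimately have "h (\<Phi> l *v \<beta>) l - h (\<Phi> l *v \<beta>avg) l + \<mu> / 2 * (norm (\<Phi> l *v (\<beta> - \<beta>avg)))\<^sup>2
      \<le> g \<bullet> (\<beta> - \<beta>avg)"
    by (simp add: matrix_vector_mult_diff_distrib norm_minus_commute inner_diff_right)
  then have 2: "2 * \<eta> * (h (\<Phi> l *v \<beta>) l - h (\<Phi> l *v \<beta>avg) l + \<mu> / 2 * (norm (\<Phi> l *v (\<beta> - \<beta>avg)))\<^sup>2)
      \<le> 2 * \<eta> * (g \<bullet> (\<beta> - \<beta>avg))"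
    using \<eta> by (intro mult_left_mono) auto
  have "(norm d)\<^sup>2 \<le> 2 * L * (h (\<Phi> l *v \<beta>) l - h (\<theta>opt l) l)"
    unfolding d_def by (rule norm_gradient_le_gap[OF convex_smooth[OF l] L_pos \<theta>opt[OF l]])
  also have "\<dots> \<le> 2 * L * (h (\<Phi> l *v \<beta>) l - h (\<Phi> l *v \<beta>') l + e)"
    using gap_le_sp_error[OF e l] L_pos by (intro mult_left_mono) auto
  finally have "C * (norm d)\<^sup>2 \<le> C * (2 * L * (h (\<Phi> l *v \<beta>) l - h (\<Phi> l *v \<beta>') l + e))"
    using C_pos by (intro mult_left_mono) auto
  then have "(norm g)\<^sup>2 \<le> C * (2 * L * (h (\<Phi> l *v \<beta>) l - h (\<Phi> l *v \<beta>') l + e))"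
    unfolding g_def by (rule order_trans[OF norm_transpose_matrix_vector_le[OF norm_\<Phi>_le[OF l]]])
  then have "\<eta>\<^sup>2 * (norm g)\<^sup>2 \<le> \<eta>\<^sup>2 * (C * (2 * L * (h (\<Phi> l *v \<beta>) l - h (\<Phi> l *v \<beta>') l + e)))"
    by (intro mult_left_mono) auto
  also have "\<dots> = 2 * \<eta>\<^sup>2 * C * L * (h (\<Phi> l *v \<beta>) l - h (\<Phi> l *v \<beta>') l + e)"
    by simp
  finally show ?thesis using 1 2 by linarith
qed

lemma nn_integral_sgd_step_le:
  assumes e: "sp_error (space M) h \<theta>opt \<Phi> \<beta>' \<le> ereal e" and \<eta>: "0 \<le> \<eta>" "\<eta> * (C * L) \<le> 1"
  shows "(\<integral>\<^sup>+l. ennreal ((norm (sgd_step \<eta> \<beta> l - \<beta>avg))\<^sup>2) \<partial>M)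
    \<le> ennreal ((1 - \<eta> * c * \<mu>) * (norm (\<beta> - \<beta>avg))\<^sup>2 + 2 * \<eta>\<^sup>2 * C * L * e)"
proof -
  define D where "D = (norm (\<beta> - \<beta>avg))\<^sup>2"
  define K where "K = 2 * \<eta>\<^sup>2 * C * L"
  define f where "f x = (\<integral>l. h (\<Phi> l *v x) l \<partial>M)" for x
  define R where "R l = D
      - 2 * \<eta> * (h (\<Phi> l *v \<beta>) l - h (\<Phi> l *v \<beta>avg) l + \<mu> / 2 * (norm (\<Phi> l *v (\<beta> - \<beta>avg)))\<^sup>2)
      + K * (h (\<Phi> l *v \<beta>) l - h (\<Phi> l *v \<beta>') l + e)" for l
  have R: "(norm (sgd_step \<eta> \<beta> l - \<beta>avg))\<^sup>2 \<le> R l" if "l \<in> space M" for l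
    unfolding R_def D_def K_def by (rule norm_sgd_step_le[OF e that \<eta>(1)])
  have 1: "integrable M (\<lambda>l. h (\<Phi> l *v \<beta>) l - h (\<Phi> l *v \<beta>avg) l + \<mu> / 2 * (norm (\<Phi> l *v (\<beta> - \<beta>avg)))\<^sup>2)"
    by (intro Bochner_Integration.integrable_add Bochner_Integration.integrable_diff
        integrable_mult_right h_integrable integrable_norm_\<Phi>)
  have 2: "integrable M (\<lambda>l. h (\<Phi> l *v \<beta>) l - h (\<Phi> l *v \<beta>') l + e)"
    by (intro Bochner_Integration.integrable_add Bochner_Integration.integrable_diff
        h_integrable integrable_const)
  have int_R: "integrable M R"
    unfolding R_def by (intro Bochner_Integration.integrable_add Bochner_Integration.integrable_diff
        integrable_mult_right 1 2 integrable_const)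
  have "(\<integral>l. R l \<partial>M) = D
      - 2 * \<eta> * (\<integral>l. h (\<Phi> l *v \<beta>) l - h (\<Phi> l *v \<beta>avg) l + \<mu> / 2 * (norm (\<Phi> l *v (\<beta> - \<beta>avg)))\<^sup>2 \<partial>M)
      + K * (\<integral>l. h (\<Phi> l *v \<beta>) l - h (\<Phi> l *v \<beta>') l + e \<partial>M)"
    unfolding R_def using 1 2 by (simp add: prob_space del: Bochner_Integration.integral_add
        Bochner_Integration.integral_diff) (simp add: Bochner_Integration.integral_add
        Bochner_Integration.integral_diff prob_space)
  also have "\<dots> = D - 2 * \<eta> * (f \<beta> - f \<beta>avg + \<mu> / 2 * (\<integral>l. (norm (\<Phi> l *v (\<beta> - \<beta>avg)))\<^sup>2 \<partial>M))
      + K * (f \<beta> - f \<beta>' + e)"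
    unfolding f_def by (simp add: h_integrable integrable_norm_\<Phi> prob_space)
  also have "\<dots> \<le> D - 2 * \<eta> * (f \<beta> - f \<beta>avg + \<mu> / 2 * (c * D)) + K * (f \<beta> - f \<beta>avg + e)"
  proof -
    have "2 * \<eta> * (f \<beta> - f \<beta>avg + \<mu> / 2 * (c * D))
        \<le> 2 * \<eta> * (f \<beta> - f \<beta>avg + \<mu> / 2 * (\<integral>l. (norm (\<Phi> l *v (\<beta> - \<beta>avg)))\<^sup>2 \<partial>M))"
      unfolding D_def using \<eta> \<mu>L integral_norm_\<Phi>_ge by (intro mult_left_mono add_left_mono) auto
    \<comment> \<open>Minimality of \<open>\<beta>avg\<close> removes the reference point, so that
      only the excess \<open>f \<beta> - f \<beta>avg\<close> remains.\<close>
    moreover have "K * (f \<beta> - f \<beta>' + e) \<le> K * (f \<beta> - f \<beta>avg + e)"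
      unfolding K_def f_def using \<beta>avg[of \<beta>'] C_pos L_pos by (intro mult_left_mono) auto
    ultimately show ?thesis by linarith
  qed
  \<comment> \<open>The noise contributes \<open>2 * \<eta>\<^sup>2 * C * L\<close> times the excess
    and the descent \<open>- 2 * \<eta>\<close> times it. The condition on \<open>\<eta>\<close>
    makes the sum nonpositive.\<close>
  also have "\<dots> = (1 - \<eta> * c * \<mu>) * D + K * e - 2 * \<eta> * (1 - \<eta> * (C * L)) * (f \<beta> - f \<beta>avg)"
    unfolding K_def by (simp add: power2_eq_square algebra_simps)
  also have "\<dots> \<le> (1 - \<eta> * c * \<mu>) * D + K * e"
    using \<eta> \<beta>avg[of \<beta>] unfolding f_def by simp
  finally have le: "(\<integral>l. R l \<partial>M) \<le> (1 - \<eta> * c * \<mu>) * D + K * e" .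
  have "(\<integral>\<^sup>+l. ennreal ((norm (sgd_step \<eta> \<beta> l - \<beta>avg))\<^sup>2) \<partial>M) \<le> (\<integral>\<^sup>+l. ennreal (R l) \<partial>M)"
    by (intro nn_integral_mono ennreal_leI R)
  also have "\<dots> = ennreal (\<integral>l. R l \<partial>M)"
    using R order_trans[OF zero_le_power2] by (intro nn_integral_eq_integral int_R AE_I2) blast
  also have "\<dots> \<le> ennreal ((1 - \<eta> * c * \<mu>) * D + K * e)"
    using le by (rule ennreal_leI)
  finally show ?thesis unfolding D_def K_def .
qed

lemma borel_measurable_sgd_step:
  assumes [measurable]: "X \<in> borel_measurable N" "Y \<in> measurable N M"
  shows "(\<lambda>x. sgd_step \<eta> (X x) (Y x)) \<in> borel_measurable N"
proof -
  have [measurable]: "(\<lambda>x. \<Phi> (Y x)) \<in> borel_measurable N"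
    by measurable
  have [measurable]: "(\<lambda>x. gradh (\<Phi> (Y x) *v X x) (Y x)) \<in> borel_measurable N"
    by (intro borel_measurable_gradh) measurable
  show ?thesis unfolding sgd_step_def by measurable
qed

text \<open>The product is indexed by \<open>n\<close> with \<open>t \<le> n\<close>, so that the
  induction on \<open>t\<close> can keep the measure space fixed.\<close>

lemma borel_measurable_sgd:
  "t \<le> n \<Longrightarrow> (\<lambda>s. sgd \<eta> \<Phi> gradh \<beta>0 s t) \<in> borel_measurable (Pi\<^sub>M {..<n} (\<lambda>_. M))"
proof (induction t)
  case (Suc t)
  then have "(\<lambda>s. s t) \<in> measurable (Pi\<^sub>M {..<n} (\<lambda>_. M)) M"
    by (intro measurable_component_singleton) simp
  with Suc show ?case
    unfolding sgd_Suc by (intro borel_measurable_sgd_step) auto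
qed simp

text \<open>The iterate is a function of the samples with index below \<open>t\<close>, hence independent of
  sample \<open>t\<close>. The library's \<open>indep_var\<close> relates variables with values in one type, so it is
  used for the two families of samples and not for the iterate itself.\<close>

lemma nn_integral_sgd_sample:
  assumes P: "prob_space P" and indep: "prob_space.indep_vars P (\<lambda>_. M) samp UNIV"
    and distr: "\<And>t. distr P M (samp t) = M"
    and F [measurable]: "F \<in> borel_measurable (borel \<Otimes>\<^sub>M M)"
  shows "(\<integral>\<^sup>+\<omega>. F (sgd \<eta> \<Phi> gradh \<beta>0 (\<lambda>t. samp t \<omega>) t, samp t \<omega>) \<partial>P)
    = (\<integral>\<^sup>+\<omega>. (\<integral>\<^sup>+l. F (sgd \<eta> \<Phi> gradh \<beta>0 (\<lambda>t. samp t \<omega>) t, l) \<partial>M) \<partial>P)"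
proof -
  interpret P: prob_space P by fact
  let ?S = "Pi\<^sub>M {..<t} (\<lambda>_. M)" and ?T = "Pi\<^sub>M {t} (\<lambda>_. M)"
  let ?past = "\<lambda>\<omega>. restrict (\<lambda>i. samp i \<omega>) {..<t}" and ?now = "\<lambda>\<omega>. restrict (\<lambda>i. samp i \<omega>) {t}"
  have samp [measurable]: "samp t \<in> measurable P M" for t
    using indep unfolding P.indep_vars_def by simp
  have ind: "P.indep_var ?S ?past ?T ?now"
    by (rule P.indep_var_restrict[OF indep]) auto
  have now [measurable]: "?now \<in> measurable P ?T"
    using P.indep_var_rv2[OF ind] .
  have proj [measurable]: "(\<lambda>y. y t) \<in> measurable ?T M"
    by (rule measurable_component_singleton) simp
  have [measurable]: "(\<lambda>s. sgd \<eta> \<Phi> gradh \<beta>0 s t) \<in> borel_measurable ?S"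
    by (rule borel_measurable_sgd) simp
  have past: "sgd \<eta> \<Phi> gradh \<beta>0 (?past \<omega>) t = sgd \<eta> \<Phi> gradh \<beta>0 (\<lambda>t. samp t \<omega>) t" for \<omega>
    by (rule sgd_cong) simp
  have "(\<lambda>z. F (sgd \<eta> \<Phi> gradh \<beta>0 (fst z) t, snd z t)) \<in> borel_measurable (?S \<Otimes>\<^sub>M ?T)"
    by measurable
  from P.nn_integral_indep_var[OF ind this]
  have "(\<integral>\<^sup>+\<omega>. F (sgd \<eta> \<Phi> gradh \<beta>0 (\<lambda>t. samp t \<omega>) t, samp t \<omega>) \<partial>P)
    = (\<integral>\<^sup>+\<omega>. (\<integral>\<^sup>+y. F (sgd \<eta> \<Phi> gradh \<beta>0 (\<lambda>t. samp t \<omega>) t, y t) \<partial>distr P ?T ?now) \<partial>P)"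
    by (simp add: past)
  moreover have "(\<integral>\<^sup>+y. F (x, y t) \<partial>distr P ?T ?now) = (\<integral>\<^sup>+l. F (x, l) \<partial>M)" for x
  proof -
    have "(\<integral>\<^sup>+y. F (x, y t) \<partial>distr P ?T ?now) = (\<integral>\<^sup>+\<omega>. F (x, samp t \<omega>) \<partial>P)"
      by (subst nn_integral_distr) simp_all
    also have "\<dots> = (\<integral>\<^sup>+l. F (x, l) \<partial>distr P M (samp t))"
      by (subst nn_integral_distr) simp_all
    finally show ?thesis unfolding distr .
  qed
  ultimately show ?thesis by simp
qed

lemma borel_measurable_sgd_samples:
  assumes P: "prob_space P" and indep: "prob_space.indep_vars P (\<lambda>_. M) samp UNIV"
  shows "(\<lambda>\<omega>. sgd \<eta> \<Phi> gradh \<beta>0 (\<lambda>t. samp t \<omega>) T) \<in> borel_measurable P"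
proof (induction T)
  case (Suc T)
  have "samp T \<in> measurable P M"
    using indep unfolding prob_space.indep_vars_def[OF P] by simp
  with Suc show ?case unfolding sgd_Suc by (rule borel_measurable_sgd_step)
qed simp

lemma nn_integral_sgd_le:
  assumes e: "sp_error (space M) h \<theta>opt \<Phi> \<beta>' \<le> ereal e" and \<eta>: "0 < \<eta>" "\<eta> * (C * L) \<le> 1"
    and P: "prob_space P" and indep: "prob_space.indep_vars P (\<lambda>_. M) samp UNIV"
    and distr: "\<And>t. distr P M (samp t) = M"
  shows "(\<integral>\<^sup>+\<omega>. ennreal ((norm (sgd \<eta> \<Phi> gradh \<beta>0 (\<lambda>t. samp t \<omega>) T - \<beta>avg))\<^sup>2) \<partial>P)
    \<le> ennreal ((1 - \<eta> * c * \<mu>) ^ T * (norm (\<beta>0 - \<beta>avg))\<^sup>2 + 2 * \<eta> * C * L * e / (c * \<mu>))"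
proof -
  interpret P: prob_space P by fact
  note e0 = sp_error_bound_nonneg[OF e]
  define r where "r = 1 - \<eta> * c * \<mu>"
  \<comment> \<open>\<open>N\<close> is the fixed point of the affine map sending x to
    \<open>r\<close> x + \<open>2 * \<eta>\<^sup>2 * C * L * e\<close>; adding it to the bound lets
    the induction close without summing a geometric series.\<close>
  define N where "N = 2 * \<eta> * C * L * e / (c * \<mu>)"
  have "c * \<mu> \<le> C * L"
    using c_pos c_le_C \<mu>L by (intro mult_mono) auto
  then have "\<eta> * (c * \<mu>) \<le> \<eta> * (C * L)"
    using \<eta> by (intro mult_left_mono) auto
  also note \<eta>(2)
  \<comment> \<open>The sign matters because \<open>ennreal\<close> is multiplicative only on
    nonnegative reals.\<close>
  finally have r: "0 \<le> r"
    unfolding r_def by (simp add: mult.assoc)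
  have N: "0 \<le> N"
    unfolding N_def using \<eta> C_pos c_pos \<mu>L e0 by (intro divide_nonneg_nonneg mult_nonneg_nonneg) auto
  have k0: "0 \<le> 2 * \<eta>\<^sup>2 * C * L * e"
    using C_pos L_pos e0 by simp
  have fix_N: "r * N + 2 * \<eta>\<^sup>2 * C * L * e = N"
    unfolding r_def N_def using c_pos \<mu>L by (simp add: field_simps power2_eq_square)
  let ?X = "\<lambda>t \<omega>. sgd \<eta> \<Phi> gradh \<beta>0 (\<lambda>t. samp t \<omega>) t"
  have "(\<integral>\<^sup>+\<omega>. ennreal ((norm (?X T \<omega> - \<beta>avg))\<^sup>2) \<partial>P) \<le> ennreal (r ^ T * (norm (\<beta>0 - \<beta>avg))\<^sup>2 + N)"
  proof (induction T)
    case 0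
    show ?case using N by (simp add: P.emeasure_space_1 ennreal_leI)
  next
    case (Suc t)
    have [measurable]: "?X t \<in> borel_measurable P"
      using P indep by (rule borel_measurable_sgd_samples)
    have G: "(\<lambda>(x, l). ennreal ((norm (sgd_step \<eta> x l - \<beta>avg))\<^sup>2)) \<in> borel_measurable (borel \<Otimes>\<^sub>M M)"
    proof -
      have [measurable]: "(\<lambda>z. sgd_step \<eta> (fst z) (snd z)) \<in> borel_measurable (borel \<Otimes>\<^sub>M M)"
        by (intro borel_measurable_sgd_step) measurable
      show ?thesis unfolding case_prod_beta' by measurable
    qed
    have "(\<integral>\<^sup>+\<omega>. ennreal ((norm (?X (Suc t) \<omega> - \<beta>avg))\<^sup>2) \<partial>P)
        = (\<integral>\<^sup>+\<omega>. (\<integral>\<^sup>+l. ennreal ((norm (sgd_step \<eta> (?X t \<omega>) l - \<beta>avg))\<^sup>2) \<partial>M) \<partial>P)"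
      using nn_integral_sgd_sample[OF P indep distr G] unfolding sgd_Suc by simp
    also have "\<dots> \<le> (\<integral>\<^sup>+\<omega>. ennreal (r * (norm (?X t \<omega> - \<beta>avg))\<^sup>2 + 2 * \<eta>\<^sup>2 * C * L * e) \<partial>P)"
      unfolding r_def using \<eta> by (intro nn_integral_mono nn_integral_sgd_step_le[OF e]) auto
    also have "\<dots> = (\<integral>\<^sup>+\<omega>. ennreal r * ennreal ((norm (?X t \<omega> - \<beta>avg))\<^sup>2)
        + ennreal (2 * \<eta>\<^sup>2 * C * L * e) \<partial>P)"
      using r k0 by (simp add: ennreal_plus ennreal_mult)
    also have "\<dots> = ennreal r * (\<integral>\<^sup>+\<omega>. ennreal ((norm (?X t \<omega> - \<beta>avg))\<^sup>2) \<partial>P)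
        + ennreal (2 * \<eta>\<^sup>2 * C * L * e)"
      by (subst nn_integral_add) (simp_all add: nn_integral_cmult P.emeasure_space_1)
    also have "\<dots> \<le> ennreal r * ennreal (r ^ t * (norm (\<beta>0 - \<beta>avg))\<^sup>2 + N) + ennreal (2 * \<eta>\<^sup>2 * C * L * e)"
      by (intro add_right_mono mult_left_mono Suc.IH) auto
    also have "\<dots> = ennreal (r * (r ^ t * (norm (\<beta>0 - \<beta>avg))\<^sup>2 + N) + 2 * \<eta>\<^sup>2 * C * L * e)"
      using r N k0 by (simp add: ennreal_plus[symmetric] ennreal_mult[symmetric] del: ennreal_plus)
    also have "r * (r ^ t * (norm (\<beta>0 - \<beta>avg))\<^sup>2 + N) + 2 * \<eta>\<^sup>2 * C * L * e
        = r ^ Suc t * (norm (\<beta>0 - \<beta>avg))\<^sup>2 + N"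
      using fix_N by (simp add: algebra_simps)
    finally show ?case .
  qed
  then show ?thesis unfolding r_def N_def .
qed

text \<open>An arbitrary reference point with error bound \<open>e\<close> is used since the infimum
  defining the minimal error need not be attained. The expected squared distance is inserted into
  \<open>sp_error_le\<close>.\<close>

lemma expected_sp_error_le:
  assumes e: "sp_error (space M) h \<theta>opt \<Phi> \<beta>' \<le> ereal e"
    and \<eta>bar: "0 < \<eta>bar" "\<eta>bar \<le> 1" and \<eta>: "\<eta> = \<eta>bar / (C * L)"
    and P: "prob_space P" and indep: "prob_space.indep_vars P (\<lambda>_. M) samp UNIV"
    and distr: "\<And>t. distr P M (samp t) = M"
  shows "ereal_expectation P
      (\<lambda>\<omega>. sp_error (space M) h \<theta>opt \<Phi> (sgd \<eta> \<Phi> gradh \<beta>0 (\<lambda>t. samp t \<omega>) T))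
    \<le> ereal (2 * C * L * (norm (\<beta>0 - \<beta>avg))\<^sup>2 * (1 - \<eta>bar * c * \<mu> / (C * L)) ^ T
      + 4 * C * L * (\<eta>bar + 2) / (c * \<mu>) * e)"
proof -
  interpret P: prob_space P by fact
  note e0 = sp_error_bound_nonneg[OF e]
  let ?X = "\<lambda>\<omega>. sgd \<eta> \<Phi> gradh \<beta>0 (\<lambda>t. samp t \<omega>) T"
  define D where "D = (norm (\<beta>0 - \<beta>avg))\<^sup>2"
  define q where "q = C * L / (c * \<mu>)"
  define B where "B = (1 - \<eta> * c * \<mu>) ^ T * D + 2 * \<eta> * C * L * e / (c * \<mu>)"
  have CL: "0 < C * L" using C_pos L_pos by simp
  have cm: "0 < c * \<mu>" using c_pos \<mu>L by simp
  have \<eta>_CL: "0 < \<eta>" "\<eta> * (C * L) = \<eta>bar"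
    using CL \<eta>bar C_pos L_pos unfolding \<eta> by auto
  have q: "0 < q" unfolding q_def using CL cm by simp
  have [measurable]: "?X \<in> borel_measurable P"
    using P indep by (rule borel_measurable_sgd_samples)
  have B: "(\<integral>\<^sup>+\<omega>. ennreal ((norm (?X \<omega> - \<beta>avg))\<^sup>2) \<partial>P) \<le> ennreal B"
    unfolding B_def D_def
    using e \<eta>_CL(1) _ P indep distr by (rule nn_integral_sgd_le) (simp add: \<eta>_CL \<eta>bar)
  have "c * \<mu> \<le> C * L"
    using c_pos c_le_C \<mu>L by (intro mult_mono) auto
  then have "\<eta> * (c * \<mu>) \<le> \<eta> * (C * L)"
    using \<eta>_CL by (intro mult_left_mono) auto
  then have "0 \<le> 1 - \<eta> * c * \<mu>"
    using \<eta>bar unfolding \<eta>_CL by (simp add: mult.assoc)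
  then have B0: "0 \<le> B"
    unfolding B_def D_def using \<eta>_CL(1) C_pos L_pos cm e0 by (intro add_nonneg_nonneg) auto
  have "(\<integral>\<^sup>+\<omega>. e2ennreal (sp_error (space M) h \<theta>opt \<Phi> (?X \<omega>)) \<partial>P)
      \<le> (\<integral>\<^sup>+\<omega>. ennreal (2 * (C * L)) * ennreal ((norm (?X \<omega> - \<beta>avg))\<^sup>2) + ennreal (6 * q * e) \<partial>P)"
  proof (rule nn_integral_mono)
    fix \<omega>
    have "e2ennreal (sp_error (space M) h \<theta>opt \<Phi> (?X \<omega>))
        \<le> e2ennreal (ereal (2 * (C * L) * (norm (?X \<omega> - \<beta>avg))\<^sup>2 + 6 * q * e))"
      using sp_error_le[OF e, of "?X \<omega>"] unfolding q_def by (intro e2ennreal_mono) (simp add: mult.assoc)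
    also have "\<dots> = ennreal (2 * (C * L) * (norm (?X \<omega> - \<beta>avg))\<^sup>2 + 6 * q * e)"
      by simp
    also have "\<dots> = ennreal (2 * (C * L)) * ennreal ((norm (?X \<omega> - \<beta>avg))\<^sup>2) + ennreal (6 * q * e)"
      using CL q e0 by (simp add: ennreal_mult ennreal_plus)
    finally show "e2ennreal (sp_error (space M) h \<theta>opt \<Phi> (?X \<omega>))
      \<le> ennreal (2 * (C * L)) * ennreal ((norm (?X \<omega> - \<beta>avg))\<^sup>2) + ennreal (6 * q * e)" .
  qed
  also have "\<dots> = ennreal (2 * (C * L)) * (\<integral>\<^sup>+\<omega>. ennreal ((norm (?X \<omega> - \<beta>avg))\<^sup>2) \<partial>P)
      + ennreal (6 * q * e)"
    by (subst nn_integral_add) (simp_all add: nn_integral_cmult P.emeasure_space_1)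
  also have "\<dots> \<le> ennreal (2 * (C * L)) * ennreal B + ennreal (6 * q * e)"
    by (intro add_right_mono mult_left_mono B) auto
  also have "\<dots> = ennreal (2 * (C * L) * B + 6 * q * e)"
    using CL q e0 B0 by (simp add: ennreal_mult ennreal_plus)
  finally have "ereal_expectation P (\<lambda>\<omega>. sp_error (space M) h \<theta>opt \<Phi> (?X \<omega>))
      \<le> enn2ereal (ennreal (2 * (C * L) * B + 6 * q * e))"
    unfolding ereal_expectation_def by (simp add: less_eq_ennreal.rep_eq)
  also have "\<dots> = ereal (2 * (C * L) * B + 6 * q * e)"
    using CL q e0 B0 by (intro enn2ereal_ennreal add_nonneg_nonneg) simp_all
  also have "\<dots> \<le> ereal (2 * C * L * D * (1 - \<eta>bar * c * \<mu> / (C * L)) ^ T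
      + 4 * C * L * (\<eta>bar + 2) / (c * \<mu>) * e)"
  \<comment> \<open>The stationary noise gives \<open>4 * \<eta>bar * q * e\<close> and the
    approximation term \<open>6 * q * e\<close>; rounding 6 up to 8 yields the stated
    constant.\<close>
  proof (subst ereal_less_eq(3))
    have "\<eta> * c * \<mu> = \<eta>bar * c * \<mu> / (C * L)"
      unfolding \<eta> by simp
    moreover have "2 * (C * L) * (2 * \<eta> * C * L * e / (c * \<mu>)) = 4 * (\<eta> * (C * L)) * q * e"
      unfolding q_def by simp
    moreover have "4 * C * L * (\<eta>bar + 2) / (c * \<mu>) * e = 4 * \<eta>bar * q * e + 8 * q * e"
      unfolding q_def by (simp add: add_divide_distrib distrib_left distrib_right mult_ac)
    moreover have "6 * q * e \<le> 8 * q * e"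
      using q e0 by (intro mult_right_mono) auto
    ultimately show "2 * (C * L) * B + 6 * q * e \<le> 2 * C * L * D * (1 - \<eta>bar * c * \<mu> / (C * L)) ^ T
      + 4 * C * L * (\<eta>bar + 2) / (c * \<mu>) * e"
      unfolding B_def \<eta>_CL(2) distrib_left by (simp add: mult_ac)
  qed
  finally show ?thesis unfolding D_def .
qed

end

section \<open>Iteration thresholds and the final bounds\<close>

lemma geometric_decay_le:
  assumes a: "1 \<le> a" and y: "0 \<le> y"
    and T: "ereal_ceiling (ereal a * ereal_ln (ereal y)) \<le> ereal (real T)"
  shows "y * (1 - 1 / a) ^ T \<le> 1"
\<comment> \<open>For \<open>y = 0\<close> the convention makes the threshold minus infinity, so
  every \<open>T\<close> qualifies, and the claim is trivial.\<close>
proof (cases "y = 0")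
  case False
  with y have y: "0 < y" by simp
  have "real_of_int \<lceil>a * ln y\<rceil> \<le> real T"
    using T y by (simp add: ereal_ln_def ereal_ceiling_def)
  then have "a * ln y \<le> real T"
    using le_of_int_ceiling order_trans by blast
  then have "ln y \<le> real T / a"
    using a by (simp add: pos_le_divide_eq mult.commute)
  then have 1: "y \<le> exp (real T / a)"
    using y by (metis exp_le_cancel_iff exp_ln)
  \<comment> \<open>The power is thus at most \<open>exp (- (real T / a))\<close>, which offsets the
    bound on \<open>y\<close> given by the threshold.\<close>
  have "1 - 1 / a \<le> exp (- (1 / a))"
    using exp_ge_add_one_self[of "- (1 / a)"] by simp
  then have "(1 - 1 / a) ^ T \<le> exp (- (1 / a)) ^ T"
    using a by (intro power_mono) auto
  also have "\<dots> = exp (- (real T / a))"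
    by (simp flip: exp_of_nat_mult)
  finally have "y * (1 - 1 / a) ^ T \<le> exp (real T / a) * exp (- (real T / a))"
    using 1 a by (intro mult_mono) auto
  then show ?thesis by (simp flip: exp_add)
qed simp

theorem theorem3p4:
  fixes M :: "'l measure"
    and h :: "real ^ 'd \<Rightarrow> 'l \<Rightarrow> real"
    and gradh :: "real ^ 'd \<Rightarrow> 'l \<Rightarrow> real ^ 'd"
    and \<theta>opt :: "'l \<Rightarrow> real ^ 'd"
    and \<Phi> :: "'l \<Rightarrow> real ^ 'p ^ 'd"
    and P :: "'w measure"
    and samp :: "nat \<Rightarrow> 'w \<Rightarrow> 'l"
    and \<beta>0 \<beta>avg :: "real ^ 'p"
    and \<epsilon>sp :: "real ^ 'p \<Rightarrow> ereal" and \<epsilon>star :: ereal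
    and \<beta>T :: "nat \<Rightarrow> 'w \<Rightarrow> real ^ 'p"
    and \<mu> L C c \<eta>bar \<eta> :: real
  assumes M: "prob_space M"
    and h_meas: "\<And>\<theta>. h \<theta> \<in> borel_measurable M"
    and \<Phi>_meas: "\<Phi> \<in> borel_measurable M"
    and h_integrable: "\<And>\<beta>. integrable M (\<lambda>l. h (\<Phi> l *v \<beta>) l)"
    and \<theta>opt: "\<And>l \<theta>. l \<in> space M \<Longrightarrow> h (\<theta>opt l) l \<le> h \<theta> l"
    and grad: "\<And>l \<theta>. l \<in> space M \<Longrightarrow> GDERIV (\<lambda>\<theta>'. h \<theta>' l) \<theta> :> gradh \<theta> l"
    and C_finite: "bdd_above ((\<lambda>l. sigma_max (transpose (\<Phi> l) ** \<Phi> l)) ` space M)"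
    and C: "C = (SUP l\<in>space M. sigma_max (transpose (\<Phi> l) ** \<Phi> l))"
    and c: "c = sigma_min (\<integral>l. transpose (\<Phi> l) ** \<Phi> l \<partial>M)"
    and \<beta>avg: "\<And>\<beta>. (\<integral>l. h (\<Phi> l *v \<beta>avg) l \<partial>M) \<le> (\<integral>l. h (\<Phi> l *v \<beta>) l \<partial>M)"
    and \<mu>L: "0 < \<mu>" "\<mu> \<le> L"
    and convex_smooth:
      "\<And>l. l \<in> space M \<Longrightarrow> strongly_convex_smooth \<mu> L (\<lambda>\<theta>. h \<theta> l) (\<lambda>\<theta>. gradh \<theta> l)"
    and indep_basis: "\<not> (\<exists>\<beta>. \<beta> \<noteq> 0 \<and> (AE l in M. \<Phi> l *v \<beta> = 0))"
    and \<eta>bar: "0 < \<eta>bar" "\<eta>bar \<le> 1"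
    and \<eta>: "\<eta> = \<eta>bar / (C * L)"
    and P: "prob_space P"
    and indep: "prob_space.indep_vars P (\<lambda>_. M) samp UNIV"
    and distr: "\<And>t. distr P M (samp t) = M"
    and \<epsilon>sp: "\<epsilon>sp = sp_error (space M) h \<theta>opt \<Phi>"
    and \<epsilon>star: "\<epsilon>star = min_sp_error (space M) h \<theta>opt \<Phi>"
    and \<beta>T: "\<beta>T = (\<lambda>T \<omega>. sgd \<eta> \<Phi> gradh \<beta>0 (\<lambda>t. samp t \<omega>) T)"
  shows "(\<forall>T. ereal_expectation P (\<lambda>\<omega>. \<epsilon>sp (\<beta>T T \<omega>))
            \<le> ereal (2 * C * L * (norm (\<beta>0 - \<beta>avg))\<^sup>2 * (1 - \<eta>bar * c * \<mu> / (C * L)) ^ T)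
               + ereal (4 * C * L * (\<eta>bar + 2) / (c * \<mu>)) * \<epsilon>star) \<and>
         (\<epsilon>star > 0 \<longrightarrow>
            (\<forall>T. ereal_ceiling (ereal (C * L / (\<eta>bar * c * \<mu>)) *
                    ereal_ln (ereal (c * \<mu> * (norm (\<beta>0 - \<beta>avg))\<^sup>2)
                              / (ereal (2 * \<eta>bar) * \<epsilon>star))) \<le> ereal (real T) \<longrightarrow>
               ereal_expectation P (\<lambda>\<omega>. \<epsilon>sp (\<beta>T T \<omega>))
                 \<le> ereal (8 * C * L * (\<eta>bar + 1) / (c * \<mu>)) * \<epsilon>star)) \<and>
         (\<epsilon>star = 0 \<longrightarrow>
            (\<forall>\<epsilon>::real. \<epsilon> > 0 \<longrightarrow>
            (\<forall>T. ereal_ceiling (ereal (C * L / (\<eta>bar * c * \<mu>)) *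
                    ereal_ln (ereal (2 * C * L * (norm (\<beta>0 - \<beta>avg))\<^sup>2 / \<epsilon>))) \<le> ereal (real T) \<longrightarrow>
               ereal_expectation P (\<lambda>\<omega>. \<epsilon>sp (\<beta>T T \<omega>)) \<le> ereal \<epsilon>)))"
proof -
  interpret solution_path_sgd M h gradh \<theta>opt \<Phi> \<beta>avg \<mu> L C c
    by (intro solution_path_sgd.intro solution_path_sgd_axioms.intro)
      (use assms in \<open>auto simp only:\<close>)
  define D where "D = (norm (\<beta>0 - \<beta>avg))\<^sup>2"
  define r where "r = 1 - \<eta>bar * c * \<mu> / (C * L)"
  define K where "K = 4 * C * L * (\<eta>bar + 2) / (c * \<mu>)"
  define a where "a = C * L / (\<eta>bar * c * \<mu>)"
  define E where "E T = ereal_expectation P (\<lambda>\<omega>. \<epsilon>sp (\<beta>T T \<omega>))" for T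
  have CL: "0 < C * L" using C_pos L_pos by simp
  have cm: "0 < c * \<mu>" using c_pos \<mu>L by simp
  have K: "0 < K" unfolding K_def using CL cm \<eta>bar by (simp add: zero_less_divide_iff zero_less_mult_iff)
  have "\<eta>bar * (c * \<mu>) \<le> 1 * (C * L)"
    using \<eta>bar c_pos c_le_C \<mu>L by (intro mult_mono) auto
  then have a: "1 \<le> a"
    unfolding a_def using cm \<eta>bar by (simp add: pos_le_divide_eq mult.assoc)
  have r: "r = 1 - 1 / a"
    unfolding r_def a_def by simp
  have D: "0 \<le> D" unfolding D_def by simp
  have sp_nonneg: "0 \<le> sp_error (space M) h \<theta>opt \<Phi> \<beta>" for \<beta>
  proof -
    obtain l where "l \<in> space M" using not_empty by blast
    then show ?thesis
      unfolding sp_error_def using \<theta>opt by (intro SUP_upper2[of l]) (auto simp: zero_ereal_def)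
  qed
  have star_nonneg: "0 \<le> \<epsilon>star"
    unfolding \<epsilon>star min_sp_error_def using sp_nonneg by (intro INF_greatest)
  have main: "E T \<le> ereal (2 * C * L * D * r ^ T) + ereal K * \<epsilon>star" for T
  proof (cases \<epsilon>star)
    case PInf
    then show ?thesis using K by simp
  next
    case MInf
    then show ?thesis using star_nonneg by simp
  next
    case (real s)
    show ?thesis
    proof (rule ereal_le_epsilon2)
      fix \<delta> :: real assume \<delta>: "0 < \<delta>"
      \<comment> \<open>The slack is divided by \<open>K\<close> so that it contributes exactly
        \<delta> after multiplication by \<open>K\<close>.\<close>
      have "\<epsilon>star < ereal (s + \<delta> / K)"
        using real K \<delta> by simp
      then obtain \<beta>' where "sp_error (space M) h \<theta>opt \<Phi> \<beta>' \<le> ereal (s + \<delta> / K)"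
        unfolding \<epsilon>star min_sp_error_def INF_less_iff by (auto intro: less_imp_le)
      from expected_sp_error_le[OF this \<eta>bar \<eta> P indep distr, of \<beta>0 T]
      have "E T \<le> ereal (2 * C * L * D * r ^ T + K * (s + \<delta> / K))"
        unfolding E_def \<epsilon>sp \<beta>T D_def r_def K_def .
      also have "\<dots> = ereal (2 * C * L * D * r ^ T) + ereal K * \<epsilon>star + ereal \<delta>"
        using K real by (simp add: distrib_left)
      finally show "E T \<le> ereal (2 * C * L * D * r ^ T) + ereal K * \<epsilon>star + ereal \<delta>" .
    qed
  qed
  have pos: "E T \<le> ereal (8 * C * L * (\<eta>bar + 1) / (c * \<mu>)) * \<epsilon>star"
    if "0 < \<epsilon>star" and T: "ereal_ceiling (ereal a *
      ereal_ln (ereal (c * \<mu> * D) / (ereal (2 * \<eta>bar) * \<epsilon>star))) \<le> ereal (real T)" for T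
  proof (cases \<epsilon>star)
    case PInf
    have "0 < 8 * C * L * (\<eta>bar + 1) / (c * \<mu>)"
      using CL cm \<eta>bar by (simp add: zero_less_divide_iff zero_less_mult_iff)
    moreover have "ereal x * \<infinity> = \<infinity>" if "0 < x" for x
      using that by simp
    ultimately have "ereal (8 * C * L * (\<eta>bar + 1) / (c * \<mu>)) * \<epsilon>star = \<infinity>"
      unfolding PInf by blast
    then show ?thesis by (simp only: ereal_less_eq(1))
  next
    case MInf
    then show ?thesis using star_nonneg by simp
  next
    case (real s)
    with that have s: "0 < s" by simp
    have y: "0 \<le> c * \<mu> * D / (2 * \<eta>bar * s)"
      using cm D \<eta>bar s by simp
    \<comment> \<open>The threshold is chosen so that the transient becomes at most
      \<open>4 * C * L * \<eta>bar / (c * \<mu>) * s\<close>; together with \<open>K * s\<close>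
      this makes the factor \<open>8 * (\<eta>bar + 1)\<close>.\<close>
    have "c * \<mu> * D / (2 * \<eta>bar * s) * r ^ T \<le> 1"
      unfolding r using T s \<eta>bar by (intro geometric_decay_le[OF a y]) (simp add: real)
    then have "c * \<mu> * (D * r ^ T) \<le> 2 * \<eta>bar * s"
      using s \<eta>bar by (simp add: pos_divide_le_eq mult_ac)
    then have "D * r ^ T \<le> 2 * \<eta>bar * s / (c * \<mu>)"
      using cm by (simp add: pos_le_divide_eq mult_ac)
    then have "2 * (C * L) * (D * r ^ T) \<le> 2 * (C * L) * (2 * \<eta>bar * s / (c * \<mu>))"
      using CL by (intro mult_left_mono) auto
    also have "\<dots> = 8 * C * L * (\<eta>bar + 1) / (c * \<mu>) * s - K * s"
      unfolding K_def by (simp add: add_divide_distrib distrib_left distrib_right mult_ac)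
    finally have "2 * C * L * D * r ^ T + K * s \<le> 8 * C * L * (\<eta>bar + 1) / (c * \<mu>) * s"
      by (simp add: mult_ac)
    then have "ereal (2 * C * L * D * r ^ T) + ereal K * \<epsilon>star
        \<le> ereal (8 * C * L * (\<eta>bar + 1) / (c * \<mu>)) * \<epsilon>star"
      unfolding real by simp
    with main show ?thesis by (rule order_trans)
  qed
  have zero: "E T \<le> ereal \<epsilon>"
    if "\<epsilon>star = 0" "0 < \<epsilon>" and T: "ereal_ceiling (ereal a *
      ereal_ln (ereal (2 * C * L * D / \<epsilon>))) \<le> ereal (real T)" for T \<epsilon>
  proof -
    have "2 * C * L * D / \<epsilon> * r ^ T \<le> 1"
      unfolding r using C_pos L_pos D that(2) by (intro geometric_decay_le[OF a _ T]) simp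
    then have "2 * C * L * D * r ^ T \<le> \<epsilon>"
      using that(2) by (simp add: pos_divide_le_eq)
    then have "ereal (2 * C * L * D * r ^ T) + ereal K * \<epsilon>star \<le> ereal \<epsilon>"
      using that(1) by simp
    with main show ?thesis by (rule order_trans)
  qed
  from main pos zero show ?thesis
    unfolding E_def D_def r_def K_def a_def by blast
qed

end
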